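(* Fix $\epsilon\in(0,1)$. Let $\boldsymbol{y}_1,\dots,\boldsymbol{y}_M$ be arbitrary (non-random) points in the ball of radius $1-\epsilon$ centred at the origin in $\mathbb{R}^n$, and for each $i$ let $\boldsymbol{x}_i$ be chosen uniformly at random from the ball of radius $\epsilon$ centred at $\boldsymbol{y}_i$, independently for different $i$. Then for any $\frac{1}{\sqrt n}<\delta<1$, the set $\{\boldsymbol{x}_1,\dots,\boldsymbol{x}_M\}$ is Fisher-separable (with respect to the centres $\boldsymbol{y}_i$) with probability at least $$1-\frac{2M^2}{\delta\sqrt n}\left(\sqrt{1-\delta^2}\right)^{n+1}-M\left(\frac{2\delta}{\epsilon}\right)^n.$$ In particular, for every $v>0$ there are constants $a>0$, $b>1$ depending only on $v$ and $\epsilon$ such that the set is Fisher-separable (with respect to the centres $\boldsymbol{y}_i$) with probability at least $1-v$ whenever $M<ab^n$.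
   Context: Fisher separability with respect to the centres $\boldsymbol{y}_i$: for each $i$, Fisher's discriminant separating $\boldsymbol{x}_i$ is computed with coordinate origin at $\boldsymbol{y}_i$, i.e. the set is Fisher-separable if for all $i$ and all $j\neq i$, $(\boldsymbol{x}_i-\boldsymbol{y}_i,\boldsymbol{x}_i-\boldsymbol{y}_i)>(\boldsymbol{x}_i-\boldsymbol{y}_i,\boldsymbol{x}_j-\boldsymbol{y}_i)$, where $(\cdot,\cdot)$ is the Euclidean inner product. *)

theory Defs
  imports "HOL-Probability.Probability"
begin

text \<open>Points of R^n are represented as functions nat => real that are
  extensional on {..<n} (elements of the space of the product measure).\<close>

definition euclid_n :: "nat \<Rightarrow> (nat \<Rightarrow> real) measure" where
  "euclid_n n = PiM {..<n} (\<lambda>_. lborel)"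

definition inner_n :: "nat \<Rightarrow> (nat \<Rightarrow> real) \<Rightarrow> (nat \<Rightarrow> real) \<Rightarrow> real" where
  "inner_n n x y = (\<Sum>k<n. x k * y k)"

definition cball_n :: "nat \<Rightarrow> (nat \<Rightarrow> real) \<Rightarrow> real \<Rightarrow> (nat \<Rightarrow> real) set" where
  "cball_n n c r = {x \<in> space (euclid_n n). sqrt (\<Sum>k<n. (x k - c k)^2) \<le> r}"

definition fisher_sep_centres ::
  "nat \<Rightarrow> nat \<Rightarrow> (nat \<Rightarrow> nat \<Rightarrow> real) \<Rightarrow> (nat \<Rightarrow> nat \<Rightarrow> real) \<Rightarrow> bool" where
  "fisher_sep_centres n M X Y =
     (\<forall>i<M. \<forall>j<M. j \<noteq> i \<longrightarrow>
        inner_n n (\<lambda>k. X i k - Y i k) (\<lambda>k. X j k - Y i k)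
        < inner_n n (\<lambda>k. X i k - Y i k) (\<lambda>k. X i k - Y i k))"

definition sample_measure ::
  "nat \<Rightarrow> nat \<Rightarrow> real \<Rightarrow> (nat \<Rightarrow> nat \<Rightarrow> real) \<Rightarrow> (nat \<Rightarrow> nat \<Rightarrow> real) measure" where
  "sample_measure n M eps Y =
     PiM {..<M} (\<lambda>i. uniform_measure (euclid_n n) (cball_n n (Y i) eps))"

definition sep_prob :: "nat \<Rightarrow> nat \<Rightarrow> real \<Rightarrow> (nat \<Rightarrow> nat \<Rightarrow> real) \<Rightarrow> real" where
  "sep_prob n M eps Y =
     measure (sample_measure n M eps Y)
       {X \<in> space (sample_measure n M eps Y). fisher_sep_centres n M X Y}"

end

theory Submission
  imports Defs
begin

text \<open>
  If separation fails for \<open>i \<noteq> j\<close>, then \<open>u = x\<^sub>i - y\<^sub>i\<close> and \<open>w = x\<^sub>j - y\<^sub>i\<close> satisfy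
  \<open>(u, w) \<ge> |u|\<^sup>2\<close>, while \<open>|w| \<le> 2\<close>.  So either \<open>|u| \<le> 2\<delta>\<close>, which has probability at most
  \<open>(2\<delta>/\<epsilon>)\<^sup>n\<close>, or \<open>u\<close> lies in the circular cone \<open>(u, w) \<ge> \<delta> |u| |w|\<close>.  Only the case
  \<open>\<delta> < \<epsilon>/2 < 1/2\<close> matters, since otherwise the bound is trivial.

  To measure the cone in coordinates without rotating space, slice along a unit vector \<open>e\<close>
  with \<open>e\<^sub>k \<noteq> 0\<close>: replace the coordinate \<open>u\<^sub>k\<close> by \<open>s = (u, e)\<close> and translate the remaining
  coordinates by \<open>s e\<close>.  Then \<open>|u|\<^sup>2 = s\<^sup>2 + Q v\<close> with a quadratic form \<open>Q\<close>, so every section is a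
  dilate of \<open>{v. Q v \<le> 1}\<close>, whose unknown volume cancels between the cone and the ball.
  What remains is the one-dimensional comparison of
  \<open>\<integral> min (1 - s\<^sup>2) (s\<^sup>2 (1/\<delta>\<^sup>2 - 1)) powr ((n - 1)/2) \<le> (1 - \<delta>\<^sup>2) powr ((n - 1)/2) / (\<delta> n)\<close> over \<open>s \<ge> 0\<close>
  with \<open>\<integral> (1 - s\<^sup>2) powr ((n - 1)/2) \<ge> 1/sqrt n\<close> over \<open>|s| \<le> 1/sqrt n\<close>.
\<close>

subsection \<open>Affine maps of the product Lebesgue measure\<close>

interpretation lborel_prod: product_sigma_finite "\<lambda>_ :: nat. lborel :: real measure"
  by standard

text \<open>Boxes determine the product measure, and on a box the claim splits into the
  one-dimensional affine rule, which contributes one factor \<open>\<bar>c\<bar>\<close> per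
  coordinate.\<close>

lemma lborel_PiM_affine:
  fixes c :: real and t :: "nat \<Rightarrow> real"
  assumes I: "finite I" and c: "c \<noteq> 0"
  shows "PiM I (\<lambda>_. lborel) =
    scale_measure (ennreal (\<bar>c\<bar> ^ card I))
      (distr (PiM I (\<lambda>_. lborel)) (PiM I (\<lambda>_. lborel)) (\<lambda>x. \<lambda>i\<in>I. t i + c * x i))"
    (is "?L = ?R")
proof (rule lborel_prod.PiM_eqI[OF I, symmetric])
  show "sets ?R = sets ?L" by simp
  fix A :: "nat \<Rightarrow> real set" assume A: "\<And>i. i \<in> I \<Longrightarrow> A i \<in> sets lborel"
  have T: "(\<lambda>x. \<lambda>i\<in>I. t i + c * x i) \<in> ?L \<rightarrow>\<^sub>M ?L"
    by measurable
  have B: "(\<lambda>x. t i + c * x) -` A i \<in> sets lborel" if "i \<in> I" for i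
  proof -
    have "(\<lambda>x. t i + c * x) -` A i \<inter> space borel \<in> sets borel"
      by (rule measurable_sets) (use A[OF that] in auto)
    then show ?thesis by simp
  qed
  have *: "(\<lambda>x. \<lambda>i\<in>I. t i + c * x i) -` Pi\<^sub>E I A \<inter> space ?L
      = Pi\<^sub>E I (\<lambda>i. (\<lambda>x. t i + c * x) -` A i)"
    by (auto simp: space_PiM PiE_iff)
  have "emeasure ?R (Pi\<^sub>E I A) = ennreal (\<bar>c\<bar> ^ card I) *
      (\<Prod>i\<in>I. emeasure lborel ((\<lambda>x. t i + c * x) -` A i))"
    using T A I lborel_prod.emeasure_PiM[OF I B] by (simp add: emeasure_distr sets_PiM_I_finite *)
  also have "\<dots> = (\<Prod>i\<in>I. ennreal \<bar>c\<bar> * emeasure lborel ((\<lambda>x. t i + c * x) -` A i))"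
    by (simp add: prod.distrib ennreal_power)
  also have "\<dots> = (\<Prod>i\<in>I. emeasure lborel (A i))"
  proof (rule prod.cong[OF refl])
    fix i assume i: "i \<in> I"
    have "emeasure lborel (A i)
        = emeasure (density (distr lborel borel (\<lambda>x. t i + c * x)) (\<lambda>_. ennreal \<bar>c\<bar>)) (A i)"
      using lborel_real_affine[OF c, of "t i"] by simp
    also have "\<dots> = ennreal \<bar>c\<bar> * emeasure lborel ((\<lambda>x. t i + c * x) -` A i)"
      using A[OF i] by (simp add: emeasure_density_const emeasure_distr)
    finally show "ennreal \<bar>c\<bar> * emeasure lborel ((\<lambda>x. t i + c * x) -` A i) = emeasure lborel (A i)"
      by simp
  qed
  finally show "emeasure ?R (Pi\<^sub>E I A) = (\<Prod>i\<in>I. emeasure lborel (A i))" .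
qed

lemma nn_integral_PiM_affine:
  fixes c :: real and t :: "nat \<Rightarrow> real"
  assumes I: "finite I" and c: "c \<noteq> 0"
    and f: "f \<in> borel_measurable (PiM I (\<lambda>_. lborel))"
  shows "(\<integral>\<^sup>+x. f x \<partial>PiM I (\<lambda>_. lborel)) =
    ennreal (\<bar>c\<bar> ^ card I) * (\<integral>\<^sup>+x. f (\<lambda>i\<in>I. t i + c * x i) \<partial>PiM I (\<lambda>_. lborel))"
proof -
  have T: "(\<lambda>x. \<lambda>i\<in>I. t i + c * x i) \<in> PiM I (\<lambda>_. lborel) \<rightarrow>\<^sub>M PiM I (\<lambda>_. lborel)"
    by measurable
  show ?thesis
    by (subst lborel_PiM_affine[OF I c, of t])
       (use f T in \<open>simp add: nn_integral_scale_measure nn_integral_distr\<close>)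
qed

lemma emeasure_PiM_affine:
  fixes c :: real and t :: "nat \<Rightarrow> real"
  assumes I: "finite I" and c: "c \<noteq> 0"
    and A: "{x \<in> space (PiM I (\<lambda>_. lborel)). P x} \<in> sets (PiM I (\<lambda>_. lborel))"
  shows "emeasure (PiM I (\<lambda>_. lborel)) {x \<in> space (PiM I (\<lambda>_. lborel)). P x} =
    ennreal (\<bar>c\<bar> ^ card I) * emeasure (PiM I (\<lambda>_. lborel))
      {x \<in> space (PiM I (\<lambda>_. lborel)). P (\<lambda>i\<in>I. t i + c * x i)}"
proof -
  let ?M = "PiM I (\<lambda>_. lborel :: real measure)" and ?T = "\<lambda>x. \<lambda>i\<in>I. t i + c * x i"
  have T: "?T \<in> ?M \<rightarrow>\<^sub>M ?M"
    by measurable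
  have "emeasure ?M {x \<in> space ?M. P x} = ennreal (\<bar>c\<bar> ^ card I) *
      emeasure ?M (?T -` {x \<in> space ?M. P x} \<inter> space ?M)"
    by (subst lborel_PiM_affine[OF I c, of t]) (use T A in \<open>simp add: emeasure_distr\<close>)
  also have "?T -` {x \<in> space ?M. P x} \<inter> space ?M = {x \<in> space ?M. P (?T x)}"
    using measurable_space[OF T] by auto
  finally show ?thesis by simp
qed

subsection \<open>Slicing along a direction\<close>

text \<open>Write \<open>u = s e + v'\<close> with \<open>v'\<close> orthogonal to \<open>e\<close>.
  If \<open>v'\<close> has coordinates \<open>v\<close> on \<open>I\<close>, orthogonality forces
  its coordinate at \<open>k\<close> to be \<open>- (\<Sum>i\<in>I. v i * e i) / e k\<close>, so the
  form added to \<open>s\<^sup>2\<close> is the squared norm of \<open>v'\<close>. The factor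
  \<open>1 / \<bar>e k\<bar>\<close> is the Jacobian of trading \<open>u k\<close> for
  \<open>s\<close>.\<close>

lemma nn_integral_slice_direction:
  fixes e :: "nat \<Rightarrow> real" and F :: "real \<Rightarrow> real \<Rightarrow> ennreal"
  assumes I: "finite I" "k \<notin> I" and unit: "(\<Sum>i\<in>insert k I. (e i)\<^sup>2) = 1" and ek: "e k \<noteq> 0"
    and [measurable]: "case_prod F \<in> borel_measurable (borel \<Otimes>\<^sub>M borel)"
  shows "(\<integral>\<^sup>+u. F (\<Sum>i\<in>insert k I. u i * e i) (\<Sum>i\<in>insert k I. (u i)\<^sup>2) \<partial>PiM (insert k I) (\<lambda>_. lborel))
    = ennreal (1 / \<bar>e k\<bar>) * (\<integral>\<^sup>+s. \<integral>\<^sup>+v. F s (s\<^sup>2 + ((\<Sum>i\<in>I. (v i)\<^sup>2) + ((\<Sum>i\<in>I. v i * e i) / e k)\<^sup>2))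
          \<partial>PiM I (\<lambda>_. lborel) \<partial>lborel)"
proof -
  let ?M = "PiM I (\<lambda>_. lborel :: real measure)"
  interpret finite_product_sigma_finite "\<lambda>_. lborel :: real measure" I
    by standard (rule I)
  interpret pair_sigma_finite lborel ?M
    by standard
  let ?d = "\<lambda>v. \<Sum>i\<in>I. v i * e i" and ?q = "\<lambda>v. \<Sum>i\<in>I. (v i)\<^sup>2"
  have "(\<integral>\<^sup>+u. F (\<Sum>i\<in>insert k I. u i * e i) (\<Sum>i\<in>insert k I. (u i)\<^sup>2) \<partial>PiM (insert k I) (\<lambda>_. lborel))
    = (\<integral>\<^sup>+x. \<integral>\<^sup>+y. F (\<Sum>i\<in>insert k I. (x(k:=y)) i * e i) (\<Sum>i\<in>insert k I. ((x(k:=y)) i)\<^sup>2) \<partial>lborel \<partial>?M)"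
    by (rule lborel_prod.product_nn_integral_insert[OF I]) measurable
  also have "\<dots> = (\<integral>\<^sup>+x. \<integral>\<^sup>+y. F (y * e k + ?d x) (y\<^sup>2 + ?q x) \<partial>lborel \<partial>?M)"
  proof (intro nn_integral_cong)
    fix x :: "nat \<Rightarrow> real" and y
    have "(\<Sum>i\<in>I. (x(k:=y)) i * e i) = ?d x" "(\<Sum>i\<in>I. ((x(k:=y)) i)\<^sup>2) = ?q x"
      using I by (auto intro!: sum.cong)
    then have "(\<Sum>i\<in>insert k I. (x(k:=y)) i * e i) = y * e k + ?d x"
      "(\<Sum>i\<in>insert k I. ((x(k:=y)) i)\<^sup>2) = y\<^sup>2 + ?q x"
      unfolding sum.insert[OF I] by simp_all
    then show "F (\<Sum>i\<in>insert k I. (x(k:=y)) i * e i) (\<Sum>i\<in>insert k I. ((x(k:=y)) i)\<^sup>2)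
      = F (y * e k + ?d x) (y\<^sup>2 + ?q x)"
      by (simp only:)
  qed
  \<comment> \<open>At fixed \<open>x\<close>, substitute \<open>s = y * e k + ?d x\<close> for
    \<open>y\<close>.\<close>
  also have "\<dots> = (\<integral>\<^sup>+x. ennreal \<bar>1 / e k\<bar> * (\<integral>\<^sup>+s. F s (((s - ?d x) / e k)\<^sup>2 + ?q x) \<partial>lborel) \<partial>?M)"
  proof (intro nn_integral_cong)
    fix x assume x: "x \<in> space ?M"
    have "(\<integral>\<^sup>+y. F (y * e k + ?d x) (y\<^sup>2 + ?q x) \<partial>lborel)
      = ennreal \<bar>1 / e k\<bar> * (\<integral>\<^sup>+s. F ((- ?d x / e k + 1 / e k * s) * e k + ?d x)
          ((- ?d x / e k + 1 / e k * s)\<^sup>2 + ?q x) \<partial>lborel)"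
      using ek by (intro nn_integral_real_affine) auto
    also have "(\<lambda>s. (- ?d x / e k + 1 / e k * s) * e k + ?d x) = (\<lambda>s. s)"
      using ek by (auto simp: field_simps)
    also have "(\<lambda>s. (- ?d x / e k + 1 / e k * s)) = (\<lambda>s. (s - ?d x) / e k)"
      by (auto simp: field_simps diff_divide_distrib)
    finally show "(\<integral>\<^sup>+y. F (y * e k + ?d x) (y\<^sup>2 + ?q x) \<partial>lborel) =
      ennreal \<bar>1 / e k\<bar> * (\<integral>\<^sup>+s. F s (((s - ?d x) / e k)\<^sup>2 + ?q x) \<partial>lborel)"
      by (simp add: fun_eq_iff)
  qed
  also have "\<dots> = ennreal (1 / \<bar>e k\<bar>) * (\<integral>\<^sup>+x. (\<integral>\<^sup>+s. F s (((s - ?d x) / e k)\<^sup>2 + ?q x) \<partial>lborel) \<partial>?M)"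
    by (simp add: nn_integral_cmult)
  also have "(\<integral>\<^sup>+x. (\<integral>\<^sup>+s. F s (((s - ?d x) / e k)\<^sup>2 + ?q x) \<partial>lborel) \<partial>?M)
    = (\<integral>\<^sup>+s. (\<integral>\<^sup>+x. F s (((s - ?d x) / e k)\<^sup>2 + ?q x) \<partial>?M) \<partial>lborel)"
    by (rule Fubini') measurable
  also have "\<dots> = (\<integral>\<^sup>+s. \<integral>\<^sup>+v. F s (s\<^sup>2 + (?q v + (?d v / e k)\<^sup>2)) \<partial>?M \<partial>lborel)"
  \<comment> \<open>For fixed \<open>s\<close> the section is centred at the coordinates of
    \<open>s e\<close>. The translation by \<open>s * e i\<close>, with scale 1 and hence no volume
    factor, moves the centre to the origin and removes the mixed terms in \<open>s\<close> and
    \<open>v\<close>.\<close>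
  proof (rule nn_integral_cong)
    fix s :: real
    have "(\<integral>\<^sup>+x. F s (((s - ?d x) / e k)\<^sup>2 + ?q x) \<partial>?M)
      = ennreal (\<bar>1\<bar> ^ card I) * (\<integral>\<^sup>+x. F s (((s - ?d (\<lambda>i\<in>I. s * e i + 1 * x i)) / e k)\<^sup>2 +
          ?q (\<lambda>i\<in>I. s * e i + 1 * x i)) \<partial>?M)"
      by (rule nn_integral_PiM_affine) (use I in auto)
    also have "\<dots> = (\<integral>\<^sup>+v. F s (s\<^sup>2 + (?q v + (?d v / e k)\<^sup>2)) \<partial>?M)"
    proof -
      have "((s - ?d (\<lambda>i\<in>I. s * e i + 1 * v i)) / e k)\<^sup>2 + ?q (\<lambda>i\<in>I. s * e i + 1 * v i)
        = s\<^sup>2 + (?q v + (?d v / e k)\<^sup>2)" for v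
      proof -
        have E: "(\<Sum>i\<in>I. (e i)\<^sup>2) = 1 - (e k)\<^sup>2"
          using unit I by simp
        have "?d (\<lambda>i\<in>I. s * e i + 1 * v i) = s * (\<Sum>i\<in>I. (e i)\<^sup>2) + ?d v"
          by (simp add: sum_distrib_left sum.distrib algebra_simps power2_eq_square)
        also have "\<dots> = s * (1 - (e k)\<^sup>2) + ?d v"
          by (simp only: E)
        finally have d: "(s - ?d (\<lambda>i\<in>I. s * e i + 1 * v i)) / e k = s * e k - ?d v / e k"
          using ek by (simp add: field_simps power2_eq_square)
        have q: "?q (\<lambda>i\<in>I. s * e i + 1 * v i) = s\<^sup>2 * (\<Sum>i\<in>I. (e i)\<^sup>2) + 2 * s * ?d v + ?q v"
          by (simp add: sum_distrib_left sum.distrib algebra_simps power2_eq_square)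
        show ?thesis
          unfolding d q E using ek by (simp add: field_simps power2_eq_square)
      qed
      then show ?thesis by simp
    qed
    finally show "(\<integral>\<^sup>+x. F s (((s - ?d x) / e k)\<^sup>2 + ?q x) \<partial>?M)
      = (\<integral>\<^sup>+v. F s (s\<^sup>2 + (?q v + (?d v / e k)\<^sup>2)) \<partial>?M)" .
  qed
  finally show ?thesis by simp
qed

text \<open>The form is homogeneous of degree 2, so the sublevel set at \<open>\<rho>\<close> is the
  dilate by \<open>sqrt \<rho>\<close> of the one at 1. All section volumes thus become multiples of
  a single number that never has to be computed.\<close>

lemma emeasure_quadratic_sublevel:
  fixes e :: "nat \<Rightarrow> real"
  assumes I: "finite I" and \<rho>: "0 < \<rho>"
  shows "emeasure (PiM I (\<lambda>_. lborel)) {v \<in> space (PiM I (\<lambda>_. lborel)).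
      (\<Sum>i\<in>I. (v i)\<^sup>2) + ((\<Sum>i\<in>I. v i * e i) / c)\<^sup>2 \<le> \<rho>}
    = ennreal (sqrt \<rho> ^ card I) * emeasure (PiM I (\<lambda>_. lborel)) {v \<in> space (PiM I (\<lambda>_. lborel)).
      (\<Sum>i\<in>I. (v i)\<^sup>2) + ((\<Sum>i\<in>I. v i * e i) / c)\<^sup>2 \<le> 1}"
proof -
  let ?Q = "\<lambda>v. (\<Sum>i\<in>I. (v i)\<^sup>2) + ((\<Sum>i\<in>I. v i * e i) / c)\<^sup>2"
  have Q: "?Q (\<lambda>i\<in>I. 0 + sqrt \<rho> * v i) = \<rho> * ?Q v" for v
  proof -
    have "(\<Sum>i\<in>I. (sqrt \<rho> * v i)\<^sup>2) = \<rho> * (\<Sum>i\<in>I. (v i)\<^sup>2)"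
      using \<rho> by (simp add: sum_distrib_left power_mult_distrib)
    moreover have "(\<Sum>i\<in>I. sqrt \<rho> * v i * e i) = sqrt \<rho> * (\<Sum>i\<in>I. v i * e i)"
      by (simp add: sum_distrib_left mult.assoc)
    ultimately show ?thesis
      using \<rho> by (simp add: power_mult_distrib power_divide algebra_simps)
  qed
  have "emeasure (PiM I (\<lambda>_. lborel)) {v \<in> space (PiM I (\<lambda>_. lborel)). ?Q v \<le> \<rho>}
    = ennreal (\<bar>sqrt \<rho>\<bar> ^ card I) * emeasure (PiM I (\<lambda>_. lborel))
       {v \<in> space (PiM I (\<lambda>_. lborel)). ?Q (\<lambda>i\<in>I. 0 + sqrt \<rho> * v i) \<le> \<rho>}"
    by (rule emeasure_PiM_affine) (use I \<rho> in auto)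
  also have "{v \<in> space (PiM I (\<lambda>_. lborel)). ?Q (\<lambda>i\<in>I. 0 + sqrt \<rho> * v i) \<le> \<rho>}
    = {v \<in> space (PiM I (\<lambda>_. lborel)). ?Q v \<le> 1}"
    unfolding Q using \<rho> by auto
  finally show ?thesis using \<rho> by simp
qed

section \<open>One-dimensional integrals of slice radii\<close>

lemma nn_integral_cap_profile:
  fixes \<delta> :: real
  assumes "0 < \<delta>" "\<delta> < 1"
  shows "(\<integral>\<^sup>+s. ennreal (s / \<delta> * sqrt (1 - s\<^sup>2) ^ m) * indicator {\<delta>..1} s \<partial>lborel)
    = ennreal (sqrt (1 - \<delta>\<^sup>2) ^ (m + 2) / (\<delta> * real (m + 2)))"
proof (rule nn_integral_has_integral_lebesgue')
  \<comment> \<open>The weight \<open>s\<close> in the integrand is, up to sign and constants, the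
    inner derivative of \<open>1 - s\<^sup>2\<close>; it makes this antiderivative
    elementary.\<close>
  let ?F = "\<lambda>s. - (sqrt (1 - s\<^sup>2) ^ (m + 2) / (\<delta> * real (m + 2)))"
  show "0 \<le> s / \<delta> * sqrt (1 - s\<^sup>2) ^ m" if "s \<in> {\<delta>..1}" for s
    using that assms by (auto intro!: mult_nonneg_nonneg simp: power_le_one_iff)
  have "((\<lambda>s. s / \<delta> * sqrt (1 - s\<^sup>2) ^ m) has_integral ?F 1 - ?F \<delta>) {\<delta>..1}"
  \<comment> \<open>The root is not differentiable at 0, so the endpoint \<open>s = 1\<close> is
    handled by continuity alone.\<close>
  proof (rule fundamental_theorem_of_calculus_interior)
    show "continuous_on {\<delta>..1} ?F"
      using assms by (intro continuous_intros) auto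
    fix s assume s: "s \<in> {\<delta><..<1}"
    then have *: "0 < 1 - s\<^sup>2"
      using assms by (simp add: power_less_one_iff abs_square_less_1)
    have "(?F has_real_derivative s / \<delta> * sqrt (1 - s\<^sup>2) ^ m) (at s)"
    proof -
      have "((\<lambda>s. sqrt (1 - s\<^sup>2)) has_real_derivative - s / sqrt (1 - s\<^sup>2)) (at s)"
        using * by (auto intro!: derivative_eq_intros simp: field_simps)
      from DERIV_minus[OF DERIV_cdivide[OF DERIV_power[OF this, of "m + 2"], of "\<delta> * real (m + 2)"]]
      show ?thesis
        by (rule DERIV_cong) (use * assms in \<open>simp add: divide_simps\<close>)
    qed
    then show "(?F has_vector_derivative s / \<delta> * sqrt (1 - s\<^sup>2) ^ m) (at s)"
      by (simp add: has_real_derivative_iff_has_vector_derivative)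
  qed (use assms in simp)
  then show "((\<lambda>s. s / \<delta> * sqrt (1 - s\<^sup>2) ^ m) has_integral
      sqrt (1 - \<delta>\<^sup>2) ^ (m + 2) / (\<delta> * real (m + 2))) {\<delta>..1}"
    by simp
qed

lemma nn_integral_power_Icc:
  fixes \<delta> c :: real
  assumes "0 \<le> \<delta>" "0 \<le> c"
  shows "(\<integral>\<^sup>+s. ennreal ((s * c) ^ m) * indicator {0..\<delta>} s \<partial>lborel)
    = ennreal (c ^ m * \<delta> ^ (m + 1) / real (m + 1))"
proof (rule nn_integral_has_integral_lebesgue')
  show "0 \<le> (s * c) ^ m" if "s \<in> {0..\<delta>}" for s
    using that assms by auto
  have "((\<lambda>s. (s * c) ^ m) has_integral
     c ^ m * \<delta> ^ (m + 1) / real (m + 1) - c ^ m * 0 ^ (m + 1) / real (m + 1)) {0..\<delta>}"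
  proof (rule fundamental_theorem_of_calculus)
    fix s :: real
    have "((\<lambda>s. c ^ m * s ^ (m + 1) / real (m + 1)) has_real_derivative (s * c) ^ m) (at s within {0..\<delta>})"
      by (rule DERIV_cong[OF DERIV_cdivide[OF DERIV_cmult[OF DERIV_pow]]])
         (simp add: power_mult_distrib divide_simps)
    then show "((\<lambda>s. c ^ m * s ^ (m + 1) / real (m + 1)) has_vector_derivative (s * c) ^ m) (at s within {0..\<delta>})"
      by (simp add: has_real_derivative_iff_has_vector_derivative)
  qed (use assms in simp)
  then show "((\<lambda>s. (s * c) ^ m) has_integral c ^ m * \<delta> ^ (m + 1) / real (m + 1)) {0..\<delta>}"
    by simp
qed

section \<open>Volumes of cone and ball by slices\<close>

text \<open>At height \<open>s\<close> the section lies in a dilate of the set on the right: up to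
  \<open>s = \<delta>\<close> the cone condition binds and the radius is
  \<open>s * \<kappa>\<close>, beyond it the ball binds and the radius is
  \<open>sqrt (1 - s\<^sup>2)\<close>. It remains to integrate the \<open>card I\<close>-th power of
  this radius.\<close>

lemma emeasure_cone_le:
  fixes e :: "nat \<Rightarrow> real"
  assumes I: "finite I" "k \<notin> I" and unit: "(\<Sum>i\<in>insert k I. (e i)\<^sup>2) = 1" and ek: "e k \<noteq> 0"
    and \<delta>: "0 < \<delta>" "\<delta> < 1"
  shows "emeasure (PiM (insert k I) (\<lambda>_. lborel)) {u \<in> space (PiM (insert k I) (\<lambda>_. lborel)).
      0 < (\<Sum>i\<in>insert k I. u i * e i) \<and>
      \<delta>\<^sup>2 * (\<Sum>i\<in>insert k I. (u i)\<^sup>2) \<le> (\<Sum>i\<in>insert k I. u i * e i)\<^sup>2 \<and>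
      (\<Sum>i\<in>insert k I. (u i)\<^sup>2) \<le> 1}
    \<le> ennreal (sqrt (1 - \<delta>\<^sup>2) ^ card I / (\<delta> * real (card I + 1))) * (ennreal (1 / \<bar>e k\<bar>) *
      emeasure (PiM I (\<lambda>_. lborel)) {v \<in> space (PiM I (\<lambda>_. lborel)).
      (\<Sum>i\<in>I. (v i)\<^sup>2) + ((\<Sum>i\<in>I. v i * e i) / e k)\<^sup>2 \<le> 1})"
proof -
  let ?M = "PiM I (\<lambda>_. lborel :: real measure)" and ?N = "PiM (insert k I) (\<lambda>_. lborel :: real measure)"
  let ?Q = "\<lambda>v. (\<Sum>i\<in>I. (v i)\<^sup>2) + ((\<Sum>i\<in>I. v i * e i) / e k)\<^sup>2"
  let ?d = "\<lambda>u. \<Sum>i\<in>insert k I. u i * e i" and ?q = "\<lambda>u. \<Sum>i\<in>insert k I. (u i)\<^sup>2"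
  let ?H = "emeasure ?M {v \<in> space ?M. ?Q v \<le> 1}"
  have [measurable]: "?d \<in> borel_measurable ?N" "?q \<in> borel_measurable ?N"
    by (intro borel_measurable_sum; measurable)+
  define m where "m = card I"
  \<comment> \<open>The tangent of the half-angle of the cone, whose cosine is
    \<open>\<delta>\<close>.\<close>
  define \<kappa> where "\<kappa> = sqrt (1 - \<delta>\<^sup>2) / \<delta>"
  define F :: "real \<Rightarrow> real \<Rightarrow> ennreal"
    where "F = (\<lambda>s p. indicator {z. 0 < fst z \<and> \<delta>\<^sup>2 * snd z \<le> (fst z)\<^sup>2 \<and> snd z \<le> 1} (s, p))"
  have \<delta>2: "0 < 1 - \<delta>\<^sup>2"
    using \<delta> by (simp add: abs_square_less_1)
  have \<kappa>: "0 < \<kappa>" using \<delta> \<delta>2 by (simp add: \<kappa>_def)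
  have \<kappa>2: "\<kappa>\<^sup>2 = 1 / \<delta>\<^sup>2 - 1"
    using \<delta> \<delta>2 by (simp add: \<kappa>_def power_divide diff_divide_distrib)
  have F: "case_prod F \<in> borel_measurable (borel \<Otimes>\<^sub>M borel)"
    unfolding F_def by measurable
  have Q0: "0 \<le> ?Q v" for v by (intro add_nonneg_nonneg sum_nonneg) auto
  \<comment> \<open>A majorant of the section volume in units of \<open>?H\<close>. On the outer
    range the power of the radius is enlarged by \<open>s / \<delta> \<ge> 1\<close> to reach the
    elementary integral; the overlap at \<open>\<delta>\<close> only increases
    \<open>g\<close>.\<close>
  define g where "g = (\<lambda>s. ennreal ((s * \<kappa>) ^ m) * indicator {0..\<delta>} s
    + ennreal (s / \<delta> * sqrt (1 - s\<^sup>2) ^ m) * indicator {\<delta>..1} s)"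
  \<comment> \<open>At \<open>s = 1\<close> the radius is 0, where the dilation argument does not
    apply; this single point is negligible in the integral over \<open>s\<close>.\<close>
  have sect: "(\<integral>\<^sup>+v. F s (s\<^sup>2 + ?Q v) \<partial>?M) \<le> g s * ?H" if s1: "s \<noteq> 1" for s
  proof -
    consider "s \<le> 0 \<or> 1 < s" | "0 < s" "s \<le> \<delta>" | "\<delta> < s" "s < 1"
      using s1 by linarith
    then show ?thesis
    proof cases
      case 1
      have "F s (s\<^sup>2 + ?Q v) = 0" for v
      proof (cases "s \<le> 0")
        case False
        then have "1 < s\<^sup>2" using 1 by (simp add: one_less_power)
        with Q0[of v] show ?thesis by (simp add: F_def)
      qed (simp add: F_def)
      then show ?thesis by simp
    next
      case 2
      have "(\<integral>\<^sup>+v. F s (s\<^sup>2 + ?Q v) \<partial>?M) \<le> (\<integral>\<^sup>+v. indicator {v \<in> space ?M. ?Q v \<le> (s * \<kappa>)\<^sup>2} v \<partial>?M)"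
      proof (rule nn_integral_mono)
        fix v assume v: "v \<in> space ?M"
        have "?Q v \<le> (s * \<kappa>)\<^sup>2" if "\<delta>\<^sup>2 * (s\<^sup>2 + ?Q v) \<le> s\<^sup>2"
          using that \<delta> unfolding power_mult_distrib \<kappa>2 by (simp add: field_simps)
        then show "F s (s\<^sup>2 + ?Q v) \<le> indicator {v \<in> space ?M. ?Q v \<le> (s * \<kappa>)\<^sup>2} v"
          using v by (auto simp: F_def indicator_def)
      qed
      also have "\<dots> = emeasure ?M {v \<in> space ?M. ?Q v \<le> (s * \<kappa>)\<^sup>2}"
        by (rule nn_integral_indicator) measurable
      also have "\<dots> = ennreal (sqrt ((s * \<kappa>)\<^sup>2) ^ card I) * ?H"
        by (rule emeasure_quadratic_sublevel) (use I 2 \<kappa> in auto)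
      also have "sqrt ((s * \<kappa>)\<^sup>2) = s * \<kappa>"
        using 2 \<kappa> by simp
      also have "ennreal ((s * \<kappa>) ^ card I) * ?H \<le> g s * ?H"
        using 2 by (intro mult_right_mono) (auto simp: g_def m_def)
      finally show ?thesis .
    next
      case 3
      have s2: "0 < 1 - s\<^sup>2" using 3 \<delta> by (simp add: abs_square_less_1)
      have "(\<integral>\<^sup>+v. F s (s\<^sup>2 + ?Q v) \<partial>?M) \<le> (\<integral>\<^sup>+v. indicator {v \<in> space ?M. ?Q v \<le> 1 - s\<^sup>2} v \<partial>?M)"
        by (rule nn_integral_mono) (auto simp: F_def indicator_def)
      also have "\<dots> = emeasure ?M {v \<in> space ?M. ?Q v \<le> 1 - s\<^sup>2}"
        by (rule nn_integral_indicator) measurable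
      also have "\<dots> = ennreal (sqrt (1 - s\<^sup>2) ^ card I) * ?H"
        by (rule emeasure_quadratic_sublevel) (use I s2 in auto)
      also have "\<dots> \<le> ennreal (s / \<delta> * sqrt (1 - s\<^sup>2) ^ m) * ?H"
      proof (intro mult_right_mono ennreal_leI)
        have "1 * sqrt (1 - s\<^sup>2) ^ m \<le> s / \<delta> * sqrt (1 - s\<^sup>2) ^ m"
          using 3 \<delta> s2 by (intro mult_right_mono) auto
        then show "sqrt (1 - s\<^sup>2) ^ card I \<le> s / \<delta> * sqrt (1 - s\<^sup>2) ^ m"
          by (simp add: m_def)
      qed simp
      also have "\<dots> \<le> g s * ?H"
        using 3 by (intro mult_right_mono) (auto simp: g_def)
      finally show ?thesis .
    qed
  qed
  have "emeasure ?N {u \<in> space ?N. 0 < ?d u \<and> \<delta>\<^sup>2 * ?q u \<le> (?d u)\<^sup>2 \<and> ?q u \<le> 1}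
    = (\<integral>\<^sup>+u. indicator {u \<in> space ?N. 0 < ?d u \<and> \<delta>\<^sup>2 * ?q u \<le> (?d u)\<^sup>2 \<and> ?q u \<le> 1} u \<partial>?N)"
    by (intro nn_integral_indicator[symmetric] sets.sets_Collect_conj borel_measurable_le
          borel_measurable_less borel_measurable_times borel_measurable_power) measurable
  also have "\<dots> = (\<integral>\<^sup>+u. F (?d u) (?q u) \<partial>?N)"
    by (intro nn_integral_cong) (auto simp: F_def indicator_def)
  also have "\<dots> = ennreal (1 / \<bar>e k\<bar>) * (\<integral>\<^sup>+s. \<integral>\<^sup>+v. F s (s\<^sup>2 + ?Q v) \<partial>?M \<partial>lborel)"
    by (rule nn_integral_slice_direction[OF I unit ek F])
  also have "(\<integral>\<^sup>+s. \<integral>\<^sup>+v. F s (s\<^sup>2 + ?Q v) \<partial>?M \<partial>lborel) \<le> (\<integral>\<^sup>+s. g s * ?H \<partial>lborel)"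
    using AE_lborel_singleton[of "1::real"] by (intro nn_integral_mono_AE) (auto intro: sect)
  also have "(\<integral>\<^sup>+s. g s * ?H \<partial>lborel) = (\<integral>\<^sup>+s. g s \<partial>lborel) * ?H"
    unfolding g_def by (rule nn_integral_multc) measurable
  also have "(\<integral>\<^sup>+s. g s \<partial>lborel) =
      ennreal (\<kappa> ^ m * \<delta> ^ (m + 1) / real (m + 1)) + ennreal (sqrt (1 - \<delta>\<^sup>2) ^ (m + 2) / (\<delta> * real (m + 2)))"
    unfolding g_def using \<delta> \<kappa>
    by (subst nn_integral_add) (auto simp only: nn_integral_cap_profile nn_integral_power_Icc less_imp_le, measurable)
  also have "\<dots> = ennreal (\<kappa> ^ m * \<delta> ^ (m + 1) / real (m + 1) + sqrt (1 - \<delta>\<^sup>2) ^ (m + 2) / (\<delta> * real (m + 2)))"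
    using \<delta> \<delta>2 \<kappa> by (intro ennreal_plus[symmetric]) auto
  also have "\<dots> \<le> ennreal (sqrt (1 - \<delta>\<^sup>2) ^ m / (\<delta> * real (m + 1)))"
  \<comment> \<open>The two terms are \<open>?w ^ m / \<delta>\<close> times
    \<open>\<delta>\<^sup>2 / (m + 1)\<close> and \<open>(1 - \<delta>\<^sup>2) / (m + 2)\<close>.
    Once \<open>m + 2\<close> is lowered to \<open>m + 1\<close>, the numerators add up to
    1.\<close>
  proof (rule ennreal_leI)
    let ?w = "sqrt (1 - \<delta>\<^sup>2)"
    have "\<kappa> ^ m * \<delta> ^ (m + 1) = ?w ^ m * \<delta>"
      using \<delta> by (simp add: \<kappa>_def power_divide)
    then have 1: "\<kappa> ^ m * \<delta> ^ (m + 1) / real (m + 1) = ?w ^ m * \<delta>\<^sup>2 / (\<delta> * real (m + 1))"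
      using \<delta> by (simp add: power2_eq_square)
    have "?w ^ (m + 2) / (\<delta> * real (m + 2)) = ?w ^ m * (1 - \<delta>\<^sup>2) / (\<delta> * real (m + 2))"
      using \<delta>2 by (simp add: power_add)
    also have "\<dots> \<le> ?w ^ m * (1 - \<delta>\<^sup>2) / (\<delta> * real (m + 1))"
      using \<delta> \<delta>2 by (intro divide_left_mono mult_left_mono) auto
    finally show "\<kappa> ^ m * \<delta> ^ (m + 1) / real (m + 1) + ?w ^ (m + 2) / (\<delta> * real (m + 2))
      \<le> ?w ^ m / (\<delta> * real (m + 1))"
      unfolding 1 by (simp add: algebra_simps diff_divide_distrib)
  qed
  finally have "emeasure ?N {u \<in> space ?N. 0 < ?d u \<and> \<delta>\<^sup>2 * ?q u \<le> (?d u)\<^sup>2 \<and> ?q u \<le> 1}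
    \<le> ennreal (1 / \<bar>e k\<bar>) * (ennreal (sqrt (1 - \<delta>\<^sup>2) ^ m / (\<delta> * real (m + 1))) * ?H)"
    by (meson mult_left_mono mult_right_mono order_trans zero_le)
  then show ?thesis
    by (simp add: m_def ac_simps)
qed

text \<open>Only the slices with \<open>\<bar>s\<bar> \<le> 1 / sqrt (card I + 1)\<close> are kept.
  Each has at least half the volume of the central one, and the interval of heights has twice this
  length. The same unknown section volume appears as in the upper bound for the cone, so that it can
  cancel.\<close>

lemma emeasure_unit_ball_ge:
  fixes e :: "nat \<Rightarrow> real"
  assumes I: "finite I" "k \<notin> I" and unit: "(\<Sum>i\<in>insert k I. (e i)\<^sup>2) = 1" and ek: "e k \<noteq> 0"
    and ne: "I \<noteq> {}"
  shows "ennreal (1 / sqrt (real (card I + 1))) * (ennreal (1 / \<bar>e k\<bar>) *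
      emeasure (PiM I (\<lambda>_. lborel)) {v \<in> space (PiM I (\<lambda>_. lborel)).
      (\<Sum>i\<in>I. (v i)\<^sup>2) + ((\<Sum>i\<in>I. v i * e i) / e k)\<^sup>2 \<le> 1})
   \<le> emeasure (PiM (insert k I) (\<lambda>_. lborel :: real measure)) {u \<in> space (PiM (insert k I) (\<lambda>_. lborel)).
      (\<Sum>i\<in>insert k I. (u i)\<^sup>2) \<le> 1}"
proof -
  let ?M = "PiM I (\<lambda>_. lborel :: real measure)" and ?N = "PiM (insert k I) (\<lambda>_. lborel :: real measure)"
  let ?Q = "\<lambda>v. (\<Sum>i\<in>I. (v i)\<^sup>2) + ((\<Sum>i\<in>I. v i * e i) / e k)\<^sup>2"
  let ?q = "\<lambda>u. \<Sum>i\<in>insert k I. (u i)\<^sup>2"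
  let ?H = "emeasure ?M {v \<in> space ?M. ?Q v \<le> 1}"
  have [measurable]: "?q \<in> borel_measurable ?N"
    by (intro borel_measurable_sum; measurable)
  define m where "m = card I"
  \<comment> \<open>A coordinate besides \<open>k\<close> ensures \<open>r < 1\<close>, so that all
    kept slices have positive radius.\<close>
  have m: "1 \<le> m" using ne I by (simp add: m_def Suc_leI card_gt_0_iff)
  define r where "r = 1 / sqrt (real (m + 1))"
  have r: "0 < r" "r\<^sup>2 = 1 / real (m + 1)" by (auto simp: r_def power_divide)
  \<comment> \<open>On this range \<open>sqrt (1 - s\<^sup>2) \<ge> 1 - 1 / (2 * m)\<close>, and
    Bernoulli's inequality bounds the \<open>m\<close>-th power of the right side below by
    1/2.\<close>
  have half: "1 / 2 \<le> sqrt (1 - s\<^sup>2) ^ m" if "\<bar>s\<bar> \<le> r" for s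
  proof -
    have "1 - 1 / (2 * real m) \<le> sqrt (1 - 1 / real (m + 1))"
      using m by (intro real_le_rsqrt) (simp add: divide_simps power2_eq_square, simp add: algebra_simps)
    also have "\<dots> \<le> sqrt (1 - s\<^sup>2)"
      using power_mono[OF that, of 2] r by simp
    finally have "(1 + - 1 / (2 * real m)) ^ m \<le> sqrt (1 - s\<^sup>2) ^ m"
      using m by (intro power_mono) (auto simp: divide_simps)
    moreover have "1 + real m * (- 1 / (2 * real m)) \<le> (1 + - 1 / (2 * real m)) ^ m"
      using m by (intro Bernoulli_inequality) (auto simp: divide_simps)
    ultimately show ?thesis using m by simp
  qed
  define F :: "real \<Rightarrow> real \<Rightarrow> ennreal"
    where "F = (\<lambda>s p. indicator {..1} p)"
  have F: "case_prod F \<in> borel_measurable (borel \<Otimes>\<^sub>M borel)"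
    unfolding F_def by measurable
  have sect: "ennreal (1 / 2) * ?H * indicator {-r..r} s \<le> (\<integral>\<^sup>+v. F s (s\<^sup>2 + ?Q v) \<partial>?M)" for s
  proof (cases "\<bar>s\<bar> \<le> r")
    case True
    have "s\<^sup>2 \<le> r\<^sup>2" using power_mono[OF True, of 2] by simp
    also have "r\<^sup>2 < 1" using m r by simp
    finally have s2: "0 < 1 - s\<^sup>2" by simp
    have "ennreal (1 / 2) * ?H * indicator {-r..r} s \<le> ennreal (sqrt (1 - s\<^sup>2) ^ card I) * ?H"
      using True ennreal_leI[OF half[OF True]]
      by (auto simp: m_def indicator_def intro!: mult_right_mono simp del: ennreal_half ennreal_divide_numeral)
    also have "\<dots> = emeasure ?M {v \<in> space ?M. ?Q v \<le> 1 - s\<^sup>2}"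
      by (rule emeasure_quadratic_sublevel[symmetric]) (use I s2 in auto)
    also have "\<dots> = (\<integral>\<^sup>+v. indicator {v \<in> space ?M. ?Q v \<le> 1 - s\<^sup>2} v \<partial>?M)"
      by (rule nn_integral_indicator[symmetric]) measurable
    also have "\<dots> = (\<integral>\<^sup>+v. F s (s\<^sup>2 + ?Q v) \<partial>?M)"
      by (rule nn_integral_cong) (auto simp: F_def indicator_def)
    finally show ?thesis .
  qed (auto simp: indicator_def)
  have "(\<integral>\<^sup>+s. ennreal (1 / 2) * ?H * indicator {-r..r} s \<partial>lborel) = ennreal (1 / 2) * ?H * ennreal (2 * r)"
    using r by (subst nn_integral_cmult_indicator) auto
  also have "\<dots> = ennreal (1 / 2 * (2 * r)) * ?H"
    by (subst ennreal_mult) (use r in \<open>auto simp only: ac_simps\<close>)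
  finally have "ennreal r * ?H = (\<integral>\<^sup>+s. ennreal (1 / 2) * ?H * indicator {-r..r} s \<partial>lborel)"
    by simp
  also have "\<dots> \<le> (\<integral>\<^sup>+s. \<integral>\<^sup>+v. F s (s\<^sup>2 + ?Q v) \<partial>?M \<partial>lborel)"
    by (intro nn_integral_mono sect)
  finally have "ennreal (1 / \<bar>e k\<bar>) * (ennreal r * ?H)
     \<le> ennreal (1 / \<bar>e k\<bar>) * (\<integral>\<^sup>+s. \<integral>\<^sup>+v. F s (s\<^sup>2 + ?Q v) \<partial>?M \<partial>lborel)"
    by (intro mult_left_mono) auto
  also have "\<dots> = (\<integral>\<^sup>+u. F (\<Sum>i\<in>insert k I. u i * e i) (?q u) \<partial>?N)"
    by (rule nn_integral_slice_direction[OF I unit ek F, symmetric])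
  also have "\<dots> = (\<integral>\<^sup>+u. indicator {u \<in> space ?N. ?q u \<le> 1} u \<partial>?N)"
    by (intro nn_integral_cong) (auto simp: F_def indicator_def)
  also have "\<dots> = emeasure ?N {u \<in> space ?N. ?q u \<le> 1}"
    by (rule nn_integral_indicator) measurable
  finally show ?thesis
    by (simp add: m_def r_def ac_simps)
qed

subsection \<open>Cones in Euclidean balls\<close>

lemma sqrt_sum_squares_le_iff:
  assumes "0 \<le> r"
  shows "sqrt (\<Sum>k<n. (x k - y k)\<^sup>2) \<le> r \<longleftrightarrow> (\<Sum>k<n. (x k - y k :: real)\<^sup>2) \<le> r\<^sup>2"
  using assms by (metis abs_of_nonneg real_sqrt_abs real_sqrt_le_iff)

lemma sets_cball_n [measurable]: "cball_n n y r \<in> sets (euclid_n n)"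
  unfolding cball_n_def euclid_n_def by measurable

text \<open>After \<open>w\<close> is normalised to \<open>e\<close>, both slice estimates contain
  the factor \<open>?K\<close>, which is thereby eliminated. The cone estimate carries
  \<open>1 / n\<close>: one factor \<open>1 / sqrt n\<close> is absorbed by the ball estimate, the
  other stays in the bound.\<close>

lemma emeasure_cone_unit_ball_le:
  fixes w :: "nat \<Rightarrow> real"
  assumes n: "2 \<le> n" and \<delta>: "0 < \<delta>" "\<delta> < 1"
  shows "emeasure (euclid_n n) {u \<in> space (euclid_n n). 0 < (\<Sum>i<n. u i * w i) \<and>
      \<delta>\<^sup>2 * (\<Sum>i<n. (u i)\<^sup>2) * (\<Sum>i<n. (w i)\<^sup>2) \<le> (\<Sum>i<n. u i * w i)\<^sup>2 \<and> (\<Sum>i<n. (u i)\<^sup>2) \<le> 1}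
    \<le> ennreal (sqrt (1 - \<delta>\<^sup>2) ^ (n - 1) / (\<delta> * sqrt (real n))) *
      emeasure (euclid_n n) {u \<in> space (euclid_n n). (\<Sum>i<n. (u i)\<^sup>2) \<le> 1}"
    (is "emeasure _ ?C \<le> _")
proof (cases "\<exists>k<n. w k \<noteq> 0")
  \<comment> \<open>A vanishing \<open>w\<close> has no direction to normalise, but the strict
    inequality then makes the cone empty.\<close>
  case False
  then have "?C = {}" by auto
  then show ?thesis by (simp only: emeasure_empty) simp
next
  case True
  then obtain k where k: "k < n" "w k \<noteq> 0" by auto
  define W where "W = sqrt (\<Sum>i<n. (w i)\<^sup>2)"
  have "0 < (\<Sum>i<n. (w i)\<^sup>2)"
    using k by (intro sum_pos2[of _ k]) auto
  then have W: "0 < W" "W\<^sup>2 = (\<Sum>i<n. (w i)\<^sup>2)" by (auto simp: W_def)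
  define e where "e = (\<lambda>i. w i / W)"
  define I where "I = {..<n} - {k}"
  have I: "finite I" "k \<notin> I" and ins: "{..<n} = insert k I" and card: "card I = n - 1"
    using k by (auto simp: I_def)
  have ek: "e k \<noteq> 0" using k W by (simp add: e_def)
  have "(\<Sum>i<n. (e i)\<^sup>2) = 1"
    using W(1) by (simp add: e_def power_divide flip: sum_divide_distrib W(2))
  then have unit: "(\<Sum>i\<in>insert k I. (e i)\<^sup>2) = 1"
    by (simp only: ins)
  have "0 < card I" using card n by simp
  then have ne: "I \<noteq> {}" by auto
  let ?N = "PiM {..<n} (\<lambda>_. lborel :: real measure)"
  let ?K = "ennreal (1 / \<bar>e k\<bar>) * emeasure (PiM I (\<lambda>_. lborel)) {v \<in> space (PiM I (\<lambda>_. lborel)).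
      (\<Sum>i\<in>I. (v i)\<^sup>2) + ((\<Sum>i\<in>I. v i * e i) / e k)\<^sup>2 \<le> 1}"
  let ?c = "sqrt (1 - \<delta>\<^sup>2) ^ (n - 1) / (\<delta> * sqrt (real n))"
  have dot: "(\<Sum>i<n. u i * w i) = W * (\<Sum>i<n. u i * e i)" for u
    using W by (simp add: e_def sum_distrib_left)
  have "?C = {u \<in> space ?N. 0 < (\<Sum>i<n. u i * e i) \<and>
      \<delta>\<^sup>2 * (\<Sum>i<n. (u i)\<^sup>2) \<le> (\<Sum>i<n. u i * e i)\<^sup>2 \<and> (\<Sum>i<n. (u i)\<^sup>2) \<le> 1}"
    using W(1) unfolding dot W(2)[symmetric] euclid_n_def
    by (auto simp: zero_less_mult_iff power_mult_distrib mult.commute[of _ "W\<^sup>2"] mult_le_cancel_left)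
  then have "emeasure (euclid_n n) ?C \<le> ennreal (sqrt (1 - \<delta>\<^sup>2) ^ card I / (\<delta> * real (card I + 1))) * ?K"
    using emeasure_cone_le[OF I unit ek \<delta>] by (simp only: ins euclid_n_def)
  also have "sqrt (1 - \<delta>\<^sup>2) ^ card I / (\<delta> * real (card I + 1)) = ?c * (1 / sqrt (real n))"
    using n by (simp add: card)
  also have "ennreal (?c * (1 / sqrt (real n))) * ?K = ennreal ?c * (ennreal (1 / sqrt (real n)) * ?K)"
    using \<delta> by (subst ennreal_mult) (auto simp: mult.assoc abs_square_le_1)
  also have "\<dots> \<le> ennreal ?c * emeasure (euclid_n n) {u \<in> space (euclid_n n). (\<Sum>i<n. (u i)\<^sup>2) \<le> 1}"
    using emeasure_unit_ball_ge[OF I unit ek ne] n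
    by (intro mult_left_mono) (simp_all only: ins euclid_n_def card zero_le le_add_diff_inverse2 Suc_leD numeral_2_eq_2 One_nat_def)
  finally show ?thesis .
qed

lemma emeasure_cball_n:
  assumes "0 < r"
  shows "emeasure (euclid_n n) (cball_n n y r) =
    ennreal (r ^ n) * emeasure (euclid_n n) {u \<in> space (euclid_n n). (\<Sum>i<n. (u i)\<^sup>2) \<le> 1}"
proof -
  have *: "(\<Sum>k<n. ((\<lambda>i\<in>{..<n}. y i + r * u i) k - y k)\<^sup>2) = r\<^sup>2 * (\<Sum>k<n. (u k)\<^sup>2)" for u
    by (simp add: sum_distrib_left power_mult_distrib)
  have "emeasure (euclid_n n) (cball_n n y r)
    = ennreal (\<bar>r\<bar> ^ card {..<n}) * emeasure (euclid_n n) {u \<in> space (euclid_n n).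
       sqrt (\<Sum>k<n. ((\<lambda>i\<in>{..<n}. y i + r * u i) k - y k)\<^sup>2) \<le> r}"
    using assms sets_cball_n[of n y r] unfolding cball_n_def euclid_n_def
    by (intro emeasure_PiM_affine) auto
  also have "{u \<in> space (euclid_n n). sqrt (\<Sum>k<n. ((\<lambda>i\<in>{..<n}. y i + r * u i) k - y k)\<^sup>2) \<le> r}
    = {u \<in> space (euclid_n n). (\<Sum>i<n. (u i)\<^sup>2) \<le> 1}"
    unfolding * using assms by (simp add: real_sqrt_mult)
  finally show ?thesis using assms by simp
qed

text \<open>The sums are abstracted to measurable functions, so that one fact serves both the cone
  in \<open>euclid_n n\<close> and the corresponding event in the sample space.\<close>

lemma sets_cone_condition:
  fixes f g h :: "'a \<Rightarrow> real"
  assumes [measurable]: "f \<in> borel_measurable M" "g \<in> borel_measurable M" "h \<in> borel_measurable M"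
  shows "{x \<in> space M. 0 < f x \<and> a * g x * h x \<le> (f x)\<^sup>2} \<in> sets M"
  by measurable

lemma sets_cone:
  "{x \<in> space (euclid_n n). 0 < (\<Sum>i<n. (x i - y i) * w i) \<and>
      \<delta>\<^sup>2 * (\<Sum>i<n. (x i - y i)\<^sup>2) * (\<Sum>i<n. (w i)\<^sup>2) \<le> (\<Sum>i<n. (x i - y i) * w i)\<^sup>2} \<in> sets (euclid_n n)"
proof (rule sets_cone_condition)
  show "(\<lambda>x. \<Sum>i<n. (x i - y i) * w i) \<in> borel_measurable (euclid_n n)"
    "(\<lambda>x. \<Sum>i<n. (x i - y i)\<^sup>2) \<in> borel_measurable (euclid_n n)"
    unfolding euclid_n_def by measurable
qed simp

text \<open>The cone condition is invariant under positive scaling of \<open>x - y\<close>, so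
  mapping \<open>u\<close> to \<open>y + r u\<close> preserves the ratio of the two volumes.\<close>

lemma emeasure_cone_cball_n_le:
  fixes w :: "nat \<Rightarrow> real"
  assumes n: "2 \<le> n" and \<delta>: "0 < \<delta>" "\<delta> < 1" and r: "0 < r"
  shows "emeasure (euclid_n n) {x \<in> cball_n n y r. 0 < (\<Sum>i<n. (x i - y i) * w i) \<and>
      \<delta>\<^sup>2 * (\<Sum>i<n. (x i - y i)\<^sup>2) * (\<Sum>i<n. (w i)\<^sup>2) \<le> (\<Sum>i<n. (x i - y i) * w i)\<^sup>2}
    \<le> ennreal (sqrt (1 - \<delta>\<^sup>2) ^ (n - 1) / (\<delta> * sqrt (real n))) * emeasure (euclid_n n) (cball_n n y r)"
proof -
  let ?T = "\<lambda>u. \<lambda>i\<in>{..<n}. y i + r * u i"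
  let ?P = "\<lambda>x. 0 < (\<Sum>i<n. (x i - y i) * w i) \<and>
      \<delta>\<^sup>2 * (\<Sum>i<n. (x i - y i)\<^sup>2) * (\<Sum>i<n. (w i)\<^sup>2) \<le> (\<Sum>i<n. (x i - y i) * w i)\<^sup>2 \<and>
      sqrt (\<Sum>i<n. (x i - y i)\<^sup>2) \<le> r"
  have q: "(\<Sum>k<n. (?T u k - y k)\<^sup>2) = r\<^sup>2 * (\<Sum>k<n. (u k)\<^sup>2)" for u
    by (simp add: sum_distrib_left power_mult_distrib)
  have d: "(\<Sum>k<n. (?T u k - y k) * w k) = r * (\<Sum>k<n. u k * w k)" for u
    by (simp add: sum_distrib_left mult.assoc)
  have P: "?P (?T u) \<longleftrightarrow> 0 < (\<Sum>i<n. u i * w i) \<and>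
      \<delta>\<^sup>2 * (\<Sum>i<n. (u i)\<^sup>2) * (\<Sum>i<n. (w i)\<^sup>2) \<le> (\<Sum>i<n. u i * w i)\<^sup>2 \<and> (\<Sum>i<n. (u i)\<^sup>2) \<le> 1" for u
    unfolding q d using r
    by (simp add: real_sqrt_mult zero_less_mult_iff power_mult_distrib mult.left_commute[of _ "r\<^sup>2"] mult.assoc)
  have "emeasure (euclid_n n) {x \<in> cball_n n y r. 0 < (\<Sum>i<n. (x i - y i) * w i) \<and>
      \<delta>\<^sup>2 * (\<Sum>i<n. (x i - y i)\<^sup>2) * (\<Sum>i<n. (w i)\<^sup>2) \<le> (\<Sum>i<n. (x i - y i) * w i)\<^sup>2}
    = emeasure (euclid_n n) {x \<in> space (euclid_n n). ?P x}"
    by (intro arg_cong[where f = "emeasure (euclid_n n)"]) (auto simp: cball_n_def)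
  also have "\<dots> = ennreal (\<bar>r\<bar> ^ card {..<n}) * emeasure (euclid_n n) {u \<in> space (euclid_n n). ?P (?T u)}"
    unfolding euclid_n_def
  proof (rule emeasure_PiM_affine)
    have "{x \<in> space (euclid_n n). ?P x} \<in> sets (euclid_n n)"
      using sets.Int[OF sets_cone sets_cball_n]
      by (rule back_subst[of "\<lambda>A. A \<in> sets (euclid_n n)"]) (auto simp: cball_n_def)
    then show "{x \<in> space (PiM {..<n} (\<lambda>_. lborel)). ?P x} \<in> sets (PiM {..<n} (\<lambda>_. lborel))"
      by (simp add: euclid_n_def)
  qed (use r in auto)
  also have "\<dots> \<le> ennreal (\<bar>r\<bar> ^ card {..<n}) *
     (ennreal (sqrt (1 - \<delta>\<^sup>2) ^ (n - 1) / (\<delta> * sqrt (real n))) *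
      emeasure (euclid_n n) {u \<in> space (euclid_n n). (\<Sum>i<n. (u i)\<^sup>2) \<le> 1})"
    unfolding P by (intro mult_left_mono emeasure_cone_unit_ball_le n \<delta>) simp
  also have "\<dots> = ennreal (sqrt (1 - \<delta>\<^sup>2) ^ (n - 1) / (\<delta> * sqrt (real n))) * emeasure (euclid_n n) (cball_n n y r)"
    unfolding emeasure_cball_n[OF r] using r by (simp add: ac_simps)
  finally show ?thesis .
qed

text \<open>Two cubes sandwich the ball. Both facts are needed to normalise by the volume and to
  cancel it.\<close>

lemma emeasure_unit_ball_pos_finite:
  "emeasure (euclid_n n) {u \<in> space (euclid_n n). (\<Sum>i<n. (u i)\<^sup>2) \<le> 1} \<noteq> 0"
  "emeasure (euclid_n n) {u \<in> space (euclid_n n). (\<Sum>i<n. (u i)\<^sup>2) \<le> 1} \<noteq> \<infinity>"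
proof -
  let ?B = "{u \<in> space (euclid_n n). (\<Sum>i<n. (u i)\<^sup>2) \<le> 1}"
  have cube: "emeasure (euclid_n n) (Pi\<^sub>E {..<n} (\<lambda>_. {-c..c})) = ennreal (2 * c) ^ n" if "0 \<le> c" for c
    unfolding euclid_n_def using that by (subst lborel_prod.emeasure_PiM) auto
  have B: "?B \<in> sets (euclid_n n)"
    unfolding euclid_n_def by measurable
  \<comment> \<open>Half the side of the inner cube. Since \<open>c \<le> 1\<close>, each squared
    coordinate is at most \<open>c\<close>, and \<open>n * c \<le> 1\<close>; the \<open>+ 1\<close>
    also covers \<open>n = 0\<close>.\<close>
  define c where "c = 1 / real (n + 1)"
  have c: "0 < c" by (simp add: c_def)
  have "Pi\<^sub>E {..<n} (\<lambda>_. {-c..c}) \<subseteq> ?B"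
  proof
    fix u assume u: "u \<in> Pi\<^sub>E {..<n} (\<lambda>_. {-c..c})"
    have "(u i)\<^sup>2 \<le> c" if "i < n" for i
    proof -
      have "u i \<in> {-c..c}" using u that by (metis PiE_mem lessThan_iff)
      then have "\<bar>u i\<bar> \<le> c" by (auto simp: abs_le_iff)
      then have "(u i)\<^sup>2 \<le> c\<^sup>2"
        using c by (simp add: abs_le_square_iff[symmetric])
      also have "\<dots> \<le> c * 1" unfolding power2_eq_square
        by (intro mult_left_mono) (auto simp: c_def)
      finally show ?thesis by simp
    qed
    then have "(\<Sum>i<n. (u i)\<^sup>2) \<le> (\<Sum>i<n. c)" by (intro sum_mono) auto
    also have "\<dots> \<le> 1" by (simp add: c_def)
    finally show "u \<in> ?B" using u by (auto simp: euclid_n_def space_PiM PiE_iff)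
  qed
  then have "ennreal (2 * c) ^ n \<le> emeasure (euclid_n n) ?B"
    using B c by (subst cube[symmetric]) (auto intro: emeasure_mono)
  moreover have "ennreal (2 * c) ^ n \<noteq> 0" using c by simp
  ultimately show "emeasure (euclid_n n) ?B \<noteq> 0" by auto
  have "?B \<subseteq> Pi\<^sub>E {..<n} (\<lambda>_. {-1..1})"
  proof
    fix u assume u: "u \<in> ?B"
    have "\<bar>u i\<bar> \<le> 1" if "i < n" for i
    proof -
      have "(u i)\<^sup>2 \<le> (\<Sum>i<n. (u i)\<^sup>2)"
        using that by (intro member_le_sum) auto
      also have "\<dots> \<le> 1" using u by simp
      finally show ?thesis by (simp add: abs_square_le_1)
    qed
    then show "u \<in> Pi\<^sub>E {..<n} (\<lambda>_. {-1..1})"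
      using u by (auto simp: euclid_n_def space_PiM PiE_iff abs_le_iff)
  qed
  then have "emeasure (euclid_n n) ?B \<le> ennreal (2 * 1) ^ n"
    by (subst cube[symmetric]) (auto intro!: emeasure_mono sets_PiM_I_finite simp: euclid_n_def)
  also have "\<dots> < \<infinity>" by (simp add: power_less_top_ennreal)
  finally show "emeasure (euclid_n n) ?B \<noteq> \<infinity>" by simp
qed

lemma emeasure_cball_n_pos_finite:
  assumes "0 < r"
  shows "emeasure (euclid_n n) (cball_n n y r) \<noteq> 0" "emeasure (euclid_n n) (cball_n n y r) \<noteq> \<infinity>"
  using assms emeasure_unit_ball_pos_finite[of n] by (auto simp: emeasure_cball_n ennreal_mult_eq_top_iff)

subsection \<open>Independent uniform samples\<close>

lemma prob_space_uniform_cball: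
  assumes "0 < r"
  shows "prob_space (uniform_measure (euclid_n n) (cball_n n y r))"
  using emeasure_cball_n_pos_finite[OF assms] by (rule prob_space_uniform_measure)

text \<open>The path from \<open>x\<close> to \<open>y\<close> to the origin to \<open>z\<close> has
  length at most \<open>\<epsilon> + 2 * (1 - \<epsilon>) \<le> 2\<close>. This is where the
  confinement of the centres enters.\<close>

lemma cball_n_dist_bound:
  assumes "x \<in> cball_n n y \<epsilon>" "y \<in> cball_n n (\<lambda>_. 0) (1 - \<epsilon>)" "z \<in> cball_n n (\<lambda>_. 0) (1 - \<epsilon>)" "0 < \<epsilon>"
  shows "(\<Sum>k<n. (x k - z k)\<^sup>2) \<le> 4"
proof -
  have eq: "L2_set (\<lambda>k. x k - z k) {..<n} = L2_set (\<lambda>k. (x k - y k) + (y k + - z k)) {..<n}"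
    by (rule L2_set_cong) auto
  have "L2_set (\<lambda>k. x k - z k) {..<n}
      \<le> L2_set (\<lambda>k. x k - y k) {..<n} + L2_set (\<lambda>k. y k + - z k) {..<n}"
    unfolding eq by (rule L2_set_triangle_ineq)
  also have "\<dots> \<le> L2_set (\<lambda>k. x k - y k) {..<n} + (L2_set y {..<n} + L2_set (\<lambda>k. - z k) {..<n})"
    by (intro add_left_mono L2_set_triangle_ineq)
  also have "\<dots> \<le> \<epsilon> + ((1 - \<epsilon>) + (1 - \<epsilon>))"
    using assms by (intro add_mono) (auto simp: L2_set_def cball_n_def)
  also have "\<dots> \<le> 2" using assms by simp
  finally have "sqrt (\<Sum>k<n. (x k - z k)\<^sup>2) \<le> 2" by (simp add: L2_set_def)
  then have "(\<Sum>k<n. (x k - z k)\<^sup>2) \<le> 2\<^sup>2" by (rule sqrt_le_D)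
  then show ?thesis by simp
qed

text \<open>A positive radius gives each ball positive finite volume, so the uniform measures are
  probability measures and their product models the independent sample.\<close>

locale uniform_ball_samples =
  fixes n M :: nat and eps \<delta> :: real and Y :: "nat \<Rightarrow> nat \<Rightarrow> real"
  assumes eps_pos: "0 < eps"
begin

abbreviation "P i \<equiv> uniform_measure (euclid_n n) (cball_n n (Y i) eps)"
abbreviation "S \<equiv> sample_measure n M eps Y"

sublocale product_prob_space P "{..<M}"
  unfolding product_prob_space_def product_prob_space_axioms_def product_sigma_finite_def
  using prob_space_uniform_cball[OF eps_pos] by (auto intro: prob_space_imp_sigma_finite)

sublocale S: prob_space S
  unfolding sample_measure_def by (rule prob_space_PiM) (rule prob_space_uniform_cball[OF eps_pos])

lemma measurable_sample_component: "i < M \<Longrightarrow> (\<lambda>X. X i) \<in> S \<rightarrow>\<^sub>M euclid_n n"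
proof -
  assume i: "i < M"
  have "(\<lambda>X. X i) \<in> S \<rightarrow>\<^sub>M P i"
    unfolding sample_measure_def using i by (intro measurable_component_singleton) auto
  then show ?thesis
    by (rule measurable_cong_sets[THEN equalityD1, THEN subsetD, rotated 2]) simp_all
qed

lemma measurable_sample_coord:
  assumes "i < M" "k < n"
  shows "(\<lambda>X. X i k) \<in> borel_measurable S"
proof -
  have "(\<lambda>x. x k) \<in> borel_measurable (euclid_n n)"
    unfolding euclid_n_def using assms by (intro measurable_PiM_component_rev) auto
  from measurable_compose[OF measurable_sample_component[OF assms(1)] this] show ?thesis .
qed

lemma measurable_sample_quadratics:
  assumes "i < M" "j < M"
  shows "(\<lambda>X. \<Sum>k<n. (X i k - Y i k)\<^sup>2) \<in> borel_measurable S"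
    "(\<lambda>X. \<Sum>k<n. (X j k - Y i k)\<^sup>2) \<in> borel_measurable S"
    "(\<lambda>X. \<Sum>k<n. (X i k - Y i k) * (X j k - Y i k)) \<in> borel_measurable S"
  using measurable_sample_coord[OF assms(1)] measurable_sample_coord[OF assms(2)]
  by (auto intro!: borel_measurable_sum borel_measurable_diff borel_measurable_power borel_measurable_times)

section \<open>Exceptional events and their probabilities\<close>

text \<open>The radius is \<open>2 * \<delta>\<close> because the other points have distance at most
  2 from \<open>Y i\<close>: beyond it, failure of separation forces the cone condition with cosine
  \<open>\<delta>\<close>.\<close>

definition small :: "nat \<Rightarrow> (nat \<Rightarrow> nat \<Rightarrow> real) set" where
  "small i = {X \<in> space S. X i \<in> cball_n n (Y i) (2 * \<delta>)}"

text \<open>The angle condition \<open>(u, w) \<ge> \<delta> |u| |w|\<close> in squared, polynomial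
  form; the strict inequality restores the sign lost by squaring.\<close>

definition inside_cone :: "nat \<Rightarrow> nat \<Rightarrow> (nat \<Rightarrow> nat \<Rightarrow> real) set" where
  "inside_cone i j = {X \<in> space S. 0 < (\<Sum>k<n. (X i k - Y i k) * (X j k - Y i k)) \<and>
     \<delta>\<^sup>2 * (\<Sum>k<n. (X i k - Y i k)\<^sup>2) * (\<Sum>k<n. (X j k - Y i k)\<^sup>2) \<le> (\<Sum>k<n. (X i k - Y i k) * (X j k - Y i k))\<^sup>2}"

lemma sets_small: "i < M \<Longrightarrow> small i \<in> sets S"
  unfolding small_def using measurable_sets[OF measurable_sample_component sets_cball_n, of i]
  by (rule back_subst[of "\<lambda>A. A \<in> sets S"]) auto

lemma sets_inside_cone:
  assumes "i < M" "j < M"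
  shows "inside_cone i j \<in> sets S"
proof -
  show ?thesis
    unfolding inside_cone_def
    by (intro sets_cone_condition measurable_sample_quadratics assms)
qed

text \<open>The marginal law of \<open>X i\<close> is uniform on its ball, so a ratio of ball
  volumes bounds the probability. Enlarging the intersection to the whole ball of radius
  \<open>2 * \<delta>\<close> avoids comparing the two radii.\<close>

lemma emeasure_small_le:
  assumes "i < M" "0 < \<delta>"
  shows "emeasure S (small i) \<le> ennreal ((2 * \<delta> / eps) ^ n)"
proof -
  let ?V = "emeasure (euclid_n n) {u \<in> space (euclid_n n). (\<Sum>i<n. (u i)\<^sup>2) \<le> 1}"
  have m: "(\<lambda>X. X i) \<in> S \<rightarrow>\<^sub>M P i"
    using measurable_sample_component[OF assms(1)] by simp
  have "emeasure S (small i) = emeasure (distr S (P i) (\<lambda>X. X i)) (cball_n n (Y i) (2 * \<delta>))"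
    by (subst emeasure_distr[OF m]) (auto simp: small_def intro!: arg_cong[where f = "emeasure S"])
  also have "distr S (P i) (\<lambda>X. X i) = P i"
    unfolding sample_measure_def using assms prob_space_uniform_cball[OF eps_pos]
    by (intro distr_PiM_component) auto
  also have "emeasure (P i) (cball_n n (Y i) (2 * \<delta>))
    = emeasure (euclid_n n) (cball_n n (Y i) eps \<inter> cball_n n (Y i) (2 * \<delta>)) / emeasure (euclid_n n) (cball_n n (Y i) eps)"
    by simp
  also have "\<dots> \<le> emeasure (euclid_n n) (cball_n n (Y i) (2 * \<delta>)) / emeasure (euclid_n n) (cball_n n (Y i) eps)"
    by (intro divide_right_mono_ennreal emeasure_mono) auto
  also have "\<dots> = ennreal ((2 * \<delta>) ^ n) * ?V / (ennreal (eps ^ n) * ?V)"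
    using assms eps_pos by (simp add: emeasure_cball_n)
  also have "\<dots> = ennreal ((2 * \<delta>) ^ n) / ennreal (eps ^ n)"
    using emeasure_unit_ball_pos_finite[of n]
    by (simp add: ennreal_mult_divide_eq divide_mult_eq)
  also have "\<dots> = ennreal ((2 * \<delta> / eps) ^ n)"
    using assms eps_pos by (simp add: divide_ennreal power_divide del: ennreal_power)
  finally show ?thesis .
qed

text \<open>Integrate over \<open>X i\<close> first, with all other points frozen. Then
  \<open>X j - Y i\<close> is a fixed vector and \<open>X i\<close> is still uniform by
  independence, so the cone estimate applies.\<close>

lemma emeasure_inside_cone_le:
  assumes ij: "i < M" "j < M" "i \<noteq> j" and n: "2 \<le> n" and \<delta>: "0 < \<delta>" "\<delta> < 1"
  shows "emeasure S (inside_cone i j) \<le> ennreal (sqrt (1 - \<delta>\<^sup>2) ^ (n - 1) / (\<delta> * sqrt (real n)))"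
    (is "_ \<le> ?c")
proof -
  define J where "J = {..<M} - {i}"
  have J: "finite J" "i \<notin> J" and ins: "{..<M} = insert i J" using ij by (auto simp: J_def)
  have S: "S = PiM (insert i J) P" by (simp add: sample_measure_def ins)
  interpret J: prob_space "PiM J P"
    by (rule prob_space_PiM) (rule prob_space_uniform_cball[OF eps_pos])
  \<comment> \<open>The cone estimate is uniform in the axis \<open>w\<close>, so this holds for
    every frozen configuration \<open>x\<close>.\<close>
  have sub: "emeasure (P i) {y \<in> space (P i). x(i := y) \<in> inside_cone i j} \<le> ?c" for x
  proof -
    define w where "w = (\<lambda>k. x j k - Y i k)"
    let ?C = "{y. 0 < (\<Sum>k<n. (y k - Y i k) * w k) \<and>
      \<delta>\<^sup>2 * (\<Sum>k<n. (y k - Y i k)\<^sup>2) * (\<Sum>k<n. (w k)\<^sup>2) \<le> (\<Sum>k<n. (y k - Y i k) * w k)\<^sup>2}"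
    have C: "{y \<in> space (euclid_n n). y \<in> ?C} \<in> sets (euclid_n n)"
      using sets_cone[of n "Y i" w \<delta>] by simp
    have "emeasure (P i) {y \<in> space (P i). x(i := y) \<in> inside_cone i j} \<le>
       emeasure (P i) {y \<in> space (euclid_n n). y \<in> ?C}"
      using C ij by (intro emeasure_mono) (auto simp: inside_cone_def w_def)
    also have "\<dots> = emeasure (euclid_n n) (cball_n n (Y i) eps \<inter> {y \<in> space (euclid_n n). y \<in> ?C}) /
      emeasure (euclid_n n) (cball_n n (Y i) eps)"
      using C by simp
    also have "cball_n n (Y i) eps \<inter> {y \<in> space (euclid_n n). y \<in> ?C} =
      {y \<in> cball_n n (Y i) eps. 0 < (\<Sum>k<n. (y k - Y i k) * w k) \<and>
      \<delta>\<^sup>2 * (\<Sum>k<n. (y k - Y i k)\<^sup>2) * (\<Sum>k<n. (w k)\<^sup>2) \<le> (\<Sum>k<n. (y k - Y i k) * w k)\<^sup>2}"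
      by (auto simp: cball_n_def)
    also have "emeasure (euclid_n n) \<dots> / emeasure (euclid_n n) (cball_n n (Y i) eps)
      \<le> (?c * emeasure (euclid_n n) (cball_n n (Y i) eps)) / emeasure (euclid_n n) (cball_n n (Y i) eps)"
      by (intro divide_right_mono_ennreal emeasure_cone_cball_n_le n \<delta> eps_pos)
    also have "\<dots> = ?c"
      using emeasure_cball_n_pos_finite[OF eps_pos] by (simp add: ennreal_mult_divide_eq)
    finally show ?thesis .
  qed
  have "emeasure S (inside_cone i j) = (\<integral>\<^sup>+X. indicator (inside_cone i j) X \<partial>PiM (insert i J) P)"
    using sets_inside_cone[OF ij(1,2)] by (simp add: S)
  also have "\<dots> = (\<integral>\<^sup>+x. \<integral>\<^sup>+y. indicator (inside_cone i j) (x(i := y)) \<partial>P i \<partial>PiM J P)"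
    using sets_inside_cone[OF ij(1,2)] by (intro product_nn_integral_insert J) (simp add: S)
  also have "\<dots> \<le> (\<integral>\<^sup>+x. ?c \<partial>PiM J P)"
  proof (rule nn_integral_mono)
    fix x assume x: "x \<in> space (PiM J P)"
    have "(\<lambda>y. x(i := y)) \<in> P i \<rightarrow>\<^sub>M S"
      unfolding S by (rule measurable_component_update[OF x J(2)])
    from measurable_sets[OF this sets_inside_cone[OF ij(1,2)]]
    have m: "{y \<in> space (P i). x(i := y) \<in> inside_cone i j} \<in> sets (P i)"
      by (simp add: vimage_def Int_def conj_commute)
    have "(\<integral>\<^sup>+y. indicator (inside_cone i j) (x(i := y)) \<partial>P i) =
      (\<integral>\<^sup>+y. indicator {y \<in> space (P i). x(i := y) \<in> inside_cone i j} y \<partial>P i)"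
      by (intro nn_integral_cong) (auto simp: indicator_def)
    also have "\<dots> = emeasure (P i) {y \<in> space (P i). x(i := y) \<in> inside_cone i j}"
      using m by (rule nn_integral_indicator)
    also have "\<dots> \<le> ?c" by (rule sub)
    finally show "(\<integral>\<^sup>+y. indicator (inside_cone i j) (x(i := y)) \<partial>P i) \<le> ?c" .
  qed
  also have "\<dots> = ?c" by (simp add: J.emeasure_space_1)
  finally show ?thesis .
qed

lemma AE_sample_in_cball: "AE X in S. \<forall>i<M. X i \<in> cball_n n (Y i) eps"
proof -
  have "AE X in S. X i \<in> cball_n n (Y i) eps" if "i < M" for i
    unfolding sample_measure_def using that prob_space_uniform_cball[OF eps_pos]
    by (intro AE_PiM_component[where M = P and P = "\<lambda>x. x \<in> cball_n n (Y i) eps"] AE_uniform_measureI) auto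
  then have "AE X in S. \<forall>i\<in>{..<M}. X i \<in> cball_n n (Y i) eps"
    by (intro AE_finite_allI) auto
  then show ?thesis by (simp add: Ball_def)
qed

text \<open>Almost every sample that is not separated lies in some \<open>small i\<close> or some
  \<open>inside_cone i j\<close>; the union bound over points and ordered pairs gives the
  claim.\<close>

lemma sep_prob_ge_union_bound:
  assumes Y: "\<forall>i<M. Y i \<in> cball_n n (\<lambda>_. 0) (1 - eps)" and n: "2 \<le> n" and \<delta>: "0 < \<delta>" "\<delta> < 1"
  shows "1 - (real M)\<^sup>2 * (sqrt (1 - \<delta>\<^sup>2) ^ (n - 1) / (\<delta> * sqrt (real n))) - real M * (2 * \<delta> / eps) ^ n
    \<le> sep_prob n M eps Y"
proof -
  let ?c = "sqrt (1 - \<delta>\<^sup>2) ^ (n - 1) / (\<delta> * sqrt (real n))"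
  define G where "G = {X \<in> space S. fisher_sep_centres n M X Y}"
  define B where "B = (\<Union>i<M. small i) \<union> (\<Union>i<M. \<Union>j\<in>{..<M} - {i}. inside_cone i j)"
  have c0: "0 \<le> ?c" using \<delta> by (auto simp: abs_square_le_1)
  have p0: "0 \<le> (2 * \<delta> / eps) ^ n" using \<delta> eps_pos by auto
  have Bs: "B \<in> sets S"
    unfolding B_def by (auto intro!: sets.Un sets.finite_UN sets_small sets_inside_cone)
  have Gs: "G \<in> sets S"
  proof -
    have "G = {X \<in> space S. \<forall>i\<in>{..<M}. \<forall>j\<in>{..<M} - {i}.
      (\<Sum>k<n. (X i k - Y i k) * (X j k - Y i k)) < (\<Sum>k<n. (X i k - Y i k)\<^sup>2)}"
      by (auto simp: G_def fisher_sep_centres_def inner_n_def power2_eq_square)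
    also have "\<dots> \<in> sets S"
      by (intro sets.sets_Collect_finite_All borel_measurable_less measurable_sample_quadratics) auto
    finally show ?thesis .
  qed
  have "S.prob (space S - G) \<le> S.prob B"
  proof (rule S.finite_measure_mono_AE)
    \<comment> \<open>The inclusion is only almost sure: the sample space contains all
      configurations, and the distance bound requires the points to lie in their balls.\<close>
    show "AE X in S. X \<in> space S - G \<longrightarrow> X \<in> B"
      using AE_sample_in_cball
    proof eventually_elim
      fix X assume X: "\<forall>i<M. X i \<in> cball_n n (Y i) eps"
      show "X \<in> space S - G \<longrightarrow> X \<in> B"
      proof
        assume XG: "X \<in> space S - G"
        then obtain i j where ij: "i < M" "j < M" "j \<noteq> i" and
          le: "(\<Sum>k<n. (X i k - Y i k)\<^sup>2) \<le> (\<Sum>k<n. (X i k - Y i k) * (X j k - Y i k))"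
            (is "?q \<le> ?d")
          by (auto simp: G_def fisher_sep_centres_def inner_n_def power2_eq_square not_less)
        let ?w = "\<Sum>k<n. (X j k - Y i k)\<^sup>2"
        have w: "0 \<le> ?w" "?w \<le> 4"
          using cball_n_dist_bound[of "X j" n "Y j" eps "Y i"] X Y ij eps_pos by (auto intro: sum_nonneg)
        show "X \<in> B"
        proof (cases "X i \<in> cball_n n (Y i) (2 * \<delta>)")
          case True
          then show ?thesis using ij XG by (auto simp: B_def small_def)
        next
          case False
          then have "\<not> sqrt ?q \<le> 2 * \<delta>"
            using X ij by (auto simp: cball_n_def)
          then have q: "4 * \<delta>\<^sup>2 < ?q"
            using sqrt_sum_squares_le_iff[of "2 * \<delta>" "X i" "Y i" n] \<delta> by (simp add: power_mult_distrib)
          have q0: "0 < ?q" using q by (smt (verit) zero_le_power2)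
          \<comment> \<open>The chain \<open>\<delta>\<^sup>2 * ?q * ?w \<le> 4 * \<delta>\<^sup>2 *
            ?q \<le> ?q * ?q \<le> ?d * ?d\<close> uses in turn the distance bound, the failure of
            \<open>small i\<close>, and the failure of separation.\<close>
          have "\<delta>\<^sup>2 * ?q * ?w \<le> \<delta>\<^sup>2 * ?q * 4"
            using w q0 by (intro mult_left_mono) auto
          also have "\<dots> = (4 * \<delta>\<^sup>2) * ?q" by simp
          also have "\<dots> \<le> ?q * ?q" using q q0 by (intro mult_right_mono) auto
          also have "\<dots> \<le> ?d * ?d" using le q0 by (intro mult_mono) auto
          finally have "X \<in> inside_cone i j"
            using le q0 XG by (simp add: inside_cone_def power2_eq_square)
          then show ?thesis using ij by (auto simp: B_def)
        qed
      qed
    qed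
  qed (rule Bs)
  also have "S.prob B \<le> S.prob (\<Union>i<M. small i) + S.prob (\<Union>i<M. \<Union>j\<in>{..<M} - {i}. inside_cone i j)"
    unfolding B_def by (intro measure_Un_le sets.finite_UN sets_small sets_inside_cone) auto
  also have "\<dots> \<le> (\<Sum>i<M. (2 * \<delta> / eps) ^ n) + (\<Sum>i<M. \<Sum>j<M. ?c)"
  proof (rule add_mono)
    have "S.prob (\<Union>i<M. small i) \<le> (\<Sum>i<M. S.prob (small i))"
      by (intro S.finite_measure_subadditive_finite image_subsetI sets_small) auto
    also have "\<dots> \<le> (\<Sum>i<M. (2 * \<delta> / eps) ^ n)"
      using emeasure_small_le \<delta> p0 by (intro sum_mono) (auto simp: S.emeasure_eq_measure)
    finally show "S.prob (\<Union>i<M. small i) \<le> (\<Sum>i<M. (2 * \<delta> / eps) ^ n)" .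
    have "S.prob (\<Union>i<M. \<Union>j\<in>{..<M} - {i}. inside_cone i j)
      \<le> (\<Sum>i<M. S.prob (\<Union>j\<in>{..<M} - {i}. inside_cone i j))"
      by (intro S.finite_measure_subadditive_finite image_subsetI sets.finite_UN sets_inside_cone) auto
    also have "\<dots> \<le> (\<Sum>i<M. \<Sum>j\<in>{..<M} - {i}. S.prob (inside_cone i j))"
      by (intro sum_mono S.finite_measure_subadditive_finite image_subsetI sets_inside_cone) auto
    also have "\<dots> \<le> (\<Sum>i<M. \<Sum>j\<in>{..<M} - {i}. ?c)"
    proof (intro sum_mono)
      fix i j assume "i \<in> {..<M}" "j \<in> {..<M} - {i}"
      then have "emeasure S (inside_cone i j) \<le> ennreal ?c"
        by (intro emeasure_inside_cone_le n \<delta>) auto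
      then show "S.prob (inside_cone i j) \<le> ?c"
        unfolding S.emeasure_eq_measure using c0 by (simp only: ennreal_le_iff)
    qed
    \<comment> \<open>Adding the diagonal turns \<open>M * (M - 1)\<close> ordered pairs into
      \<open>M * M\<close>.\<close>
    also have "\<dots> \<le> (\<Sum>i<M. \<Sum>j<M. ?c)"
      using c0 by (intro sum_mono sum_mono2) auto
    finally show "S.prob (\<Union>i<M. \<Union>j\<in>{..<M} - {i}. inside_cone i j) \<le> (\<Sum>i<M. \<Sum>j<M. ?c)" .
  qed
  finally have "S.prob (space S - G) \<le> real M * (2 * \<delta> / eps) ^ n + (real M)\<^sup>2 * ?c"
    by (simp add: power2_eq_square mult.assoc)
  then show ?thesis
    unfolding S.prob_compl[OF Gs] by (simp add: sep_prob_def G_def)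
qed

end

lemma sep_prob_0: "sep_prob n 0 eps Y = 1"
proof -
  have "prob_space (sample_measure n 0 eps Y)"
    unfolding sample_measure_def by (rule prob_space_PiM) auto
  then show ?thesis
    by (simp add: sep_prob_def fisher_sep_centres_def prob_space.prob_space)
qed

subsection \<open>Separation probability\<close>

text \<open>The union bound has the power \<open>n - 1\<close> of the root; passing to
  \<open>n + 1\<close> costs the factor \<open>1 - \<delta>\<^sup>2\<close>, for which the constant
  2 compensates when \<open>\<delta> < 1 / 2\<close>. Otherwise the claimed bound is
  trivial.\<close>

lemma sep_prob_lower_bound:
  assumes eps: "0 < eps" "eps < 1" and Y: "\<forall>i<M. Y i \<in> cball_n n (\<lambda>_. 0) (1 - eps)"
    and n: "1 \<le> n" and \<delta>: "1 / sqrt (real n) < \<delta>" "\<delta> < 1"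
  shows "1 - 2 * (real M)\<^sup>2 / (\<delta> * sqrt (real n)) * (sqrt (1 - \<delta>\<^sup>2)) ^ (n + 1)
      - real M * (2 * \<delta> / eps) ^ n \<le> sep_prob n M eps Y"
proof -
  have "0 < 1 / sqrt (real n)" using n by simp
  then have \<delta>0: "0 < \<delta>" using \<delta>(1) by linarith
  \<comment> \<open>For \<open>n = 1\<close> no \<open>\<delta>\<close> lies strictly between
    \<open>1 / sqrt n\<close> and 1.\<close>
  have n2: "2 \<le> n"
    using n \<delta> by (cases "n = 1") auto
  have w: "0 < 1 - \<delta>\<^sup>2" using \<delta>0 \<delta> by (simp add: abs_square_less_1)
  have nn: "0 \<le> 2 * (real M)\<^sup>2 / (\<delta> * sqrt (real n)) * (sqrt (1 - \<delta>\<^sup>2)) ^ (n + 1)"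
    using \<delta>0 w by auto
  consider "M = 0" | "1 \<le> M" "eps \<le> 2 * \<delta>" | "2 * \<delta> < eps"
    by linarith
  then show ?thesis
  proof cases
    case 1
    then show ?thesis by (simp add: sep_prob_0)
  next
    case 2
    \<comment> \<open>The last subtracted term alone is at least 1, so the lower bound is not
      positive.\<close>
    have "1 * 1 \<le> real M * (2 * \<delta> / eps) ^ n"
      using 2 eps by (intro mult_mono one_le_power) auto
    moreover have "0 \<le> sep_prob n M eps Y"
      by (simp add: sep_prob_def)
    ultimately show ?thesis using nn by linarith
  next
    case 3
    interpret uniform_ball_samples n M eps \<delta> Y
      by standard (rule eps)
    have "\<delta>\<^sup>2 \<le> (1 / 2)\<^sup>2" using 3 eps \<delta>0 by (intro power_mono) auto
    then have w2: "1 \<le> 2 * (1 - \<delta>\<^sup>2)" by (simp add: power2_eq_square)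
    have "n + 1 = (n - 1) + 2" using n by simp
    then have "sqrt (1 - \<delta>\<^sup>2) ^ (n + 1) = sqrt (1 - \<delta>\<^sup>2) ^ (n - 1) * (1 - \<delta>\<^sup>2)"
      using w by (simp only: power_add) simp
    then have "2 * (real M)\<^sup>2 / (\<delta> * sqrt (real n)) * (sqrt (1 - \<delta>\<^sup>2)) ^ (n + 1)
      = (2 * (1 - \<delta>\<^sup>2)) * ((real M)\<^sup>2 * (sqrt (1 - \<delta>\<^sup>2) ^ (n - 1) / (\<delta> * sqrt (real n))))"
      by simp
    moreover have "1 * ((real M)\<^sup>2 * (sqrt (1 - \<delta>\<^sup>2) ^ (n - 1) / (\<delta> * sqrt (real n)))) \<le> \<dots>"
      using w2 w \<delta>0 by (intro mult_right_mono) auto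
    ultimately show ?thesis
      using sep_prob_ge_union_bound[OF Y n2 \<delta>0 \<delta>(2)] by linarith
  qed
qed

text \<open>With \<open>\<delta>\<close> fixed in terms of \<open>eps\<close>, both error terms
  decay exponentially in \<open>n\<close>. The base \<open>b\<close> grows slowly enough for
  \<open>M\<close> and its square to be absorbed, and \<open>a\<close> makes the remainder
  small.\<close>

lemma sep_prob_exponential_size:
  assumes eps: "0 < eps" "eps < 1" and v: "0 < (v::real)"
  shows "\<exists>a>0. \<exists>b>1. \<forall>n M Y. 1 \<le> n \<longrightarrow> (\<forall>i<M. Y i \<in> cball_n n (\<lambda>_. 0) (1 - eps)) \<longrightarrow>
            real M < a * b^n \<longrightarrow> 1 - v \<le> sep_prob n M eps Y"
proof -
  \<comment> \<open>This choice makes \<open>(2 * \<delta> / eps) ^ n\<close> equal to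
    \<open>1 / 2 ^ n\<close>.\<close>
  define \<delta> where "\<delta> = eps / 4"
  have \<delta>: "0 < \<delta>" "\<delta> < 1" using eps by (auto simp: \<delta>_def)
  define q where "q = sqrt (1 - \<delta>\<^sup>2)"
  have "0 < \<delta>\<^sup>2" "\<delta>\<^sup>2 < 1" using \<delta> by (auto simp: abs_square_less_1)
  then have q: "0 < q" "q < 1" by (auto simp: q_def)
  \<comment> \<open>The bound 2 controls \<open>M / 2 ^ n\<close>; the bound
    \<open>1 / sqrt q\<close> gives \<open>b\<^sup>2 * q \<le> 1\<close> and controls the term
    quadratic in \<open>M\<close>.\<close>
  define b where "b = min 2 (1 / sqrt q)"
  have b: "1 < b" "b \<le> 2" using q by (auto simp: b_def)
  have "b\<^sup>2 \<le> (1 / sqrt q)\<^sup>2" using b q by (intro power_mono) (auto simp: b_def)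
  then have bq: "b\<^sup>2 * q \<le> 1" using q by (simp add: power_divide field_simps)
  \<comment> \<open>From dimension \<open>N\<close> on, \<open>\<delta>\<close> exceeds
    \<open>1 / sqrt n\<close>, as the probability bound requires.\<close>
  obtain N :: nat where N: "1 / \<delta>\<^sup>2 < real N" using reals_Archimedean2 by blast
  \<comment> \<open>The cone term will cost at most \<open>2 * a\<close> and the small-ball term at
    most \<open>a\<close>, hence \<open>v / 3\<close>. The factor \<open>1 / b ^ N\<close> forces
    \<open>M = 0\<close> in the dimensions below \<open>N\<close>.\<close>
  define a where "a = min (min 1 (v / 3)) (1 / b ^ N)"
  have a: "0 < a" "a \<le> 1" "3 * a \<le> v" "a * b ^ N \<le> 1"
  proof -
    have "a \<le> 1 / b ^ N" by (simp add: a_def)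
    then show "a * b ^ N \<le> 1" using b by (simp add: field_simps)
  qed (use v b in \<open>auto simp: a_def\<close>)
  have "1 - v \<le> sep_prob n M eps Y"
    if n: "1 \<le> n" and Y: "\<forall>i<M. Y i \<in> cball_n n (\<lambda>_. 0) (1 - eps)" and M: "real M < a * b ^ n" for n M Y
  proof (cases "n < N")
    case True
    have "a * b ^ n \<le> a * b ^ N"
      using True a b by (intro mult_left_mono power_increasing) auto
    then have "M = 0" using M a(4) by linarith
    then show ?thesis using v by (simp add: sep_prob_0)
  next
    case False
    then have "1 / \<delta>\<^sup>2 < real n" using N by linarith
    then have "sqrt (1 / \<delta>\<^sup>2) < sqrt (real n)" by (simp only: real_sqrt_less_iff)
    then have "1 / \<delta> < sqrt (real n)" using \<delta> by (simp add: real_sqrt_divide)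
    then have n\<delta>: "1 < \<delta> * sqrt (real n)" using \<delta> by (simp add: field_simps)
    then have n\<delta>': "1 / sqrt (real n) < \<delta>" using n by (simp add: field_simps)
    have "(real M)\<^sup>2 * q ^ (n + 1) \<le> (real M)\<^sup>2 * q ^ n"
      using q by (intro mult_left_mono power_decreasing) auto
    also have "\<dots> \<le> (a * b ^ n)\<^sup>2 * q ^ n"
      using M q by (intro mult_right_mono power_mono) auto
    also have "\<dots> = a\<^sup>2 * (b\<^sup>2 * q) ^ n"
      by (simp add: power_mult_distrib power_mult[symmetric] mult.commute)
    also have "\<dots> \<le> a\<^sup>2 * 1"
      using bq q b by (intro mult_left_mono power_le_one) auto
    also have "\<dots> \<le> a"
      using mult_left_mono[OF a(2), of a] a(1) by (simp add: power2_eq_square)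
    finally have 1: "(real M)\<^sup>2 * q ^ (n + 1) \<le> a" .
    have "2 * (real M)\<^sup>2 / (\<delta> * sqrt (real n)) * q ^ (n + 1) = 2 * ((real M)\<^sup>2 * q ^ (n + 1)) / (\<delta> * sqrt (real n))"
      by simp
    also have "\<dots> \<le> 2 * ((real M)\<^sup>2 * q ^ (n + 1)) / 1"
      using n\<delta> q by (intro divide_left_mono) auto
    finally have 2: "2 * (real M)\<^sup>2 / (\<delta> * sqrt (real n)) * q ^ (n + 1) \<le> 2 * a" using 1 by simp
    have "real M * (2 * \<delta> / eps) ^ n = real M / 2 ^ n"
      using eps by (simp add: \<delta>_def power_divide)
    also have "\<dots> \<le> a * b ^ n / 2 ^ n" using M by (intro divide_right_mono) auto
    also have "\<dots> \<le> a * 2 ^ n / 2 ^ n"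
      using b a by (intro divide_right_mono mult_left_mono power_mono) auto
    finally have 3: "real M * (2 * \<delta> / eps) ^ n \<le> a" by simp
    show ?thesis
      using sep_prob_lower_bound[OF eps Y n n\<delta>' \<delta>(2)] 2 3 a(3) unfolding q_def by linarith
  qed
  then show ?thesis using a(1) b(1) by blast
qed

theorem theorem6:
  fixes eps :: real
  assumes "0 < eps" and "eps < 1"
  shows "(\<forall>n M (Y :: nat \<Rightarrow> nat \<Rightarrow> real) (\<delta> :: real).
            1 \<le> n \<longrightarrow> (\<forall>i<M. Y i \<in> cball_n n (\<lambda>_. 0) (1 - eps)) \<longrightarrow>
            1 / sqrt (real n) < \<delta> \<longrightarrow> \<delta> < 1 \<longrightarrow>
            sep_prob n M eps Y \<ge>
              1 - 2 * (real M)^2 / (\<delta> * sqrt (real n)) * (sqrt (1 - \<delta>^2))^(n+1)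
                - real M * (2 * \<delta> / eps)^n)
       \<and> (\<forall>v > 0. \<exists>a > 0. \<exists>b > 1. \<forall>n M (Y :: nat \<Rightarrow> nat \<Rightarrow> real).
            1 \<le> n \<longrightarrow> (\<forall>i<M. Y i \<in> cball_n n (\<lambda>_. 0) (1 - eps)) \<longrightarrow>
            real M < a * b^n \<longrightarrow> sep_prob n M eps Y \<ge> 1 - v)"
  using sep_prob_lower_bound[OF assms] sep_prob_exponential_size[OF assms] by blast

end
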